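(* Let $\kappa$ be a cardinal, let $\mathbf X=(X,\mathcal E)$ and $\mathbf Y=(Y,\mathcal F)$ be coarse spaces, let $\mathcal H_{\mathbf X}$ be an $\mathbf X$-module and $\mathcal H_{\mathbf Y}$ a $\mathbf Y$-module. If $\mathcal H_{\mathbf X}$ and $\mathcal H_{\mathbf Y}$ are both discrete and $\kappa$-ample of rank $\kappa$, then for every coarse map $\mathbf f\colon\mathbf X\to\mathbf Y$ there is a controlled isometry $t\colon\mathcal H_{\mathbf X}\to\mathcal H_{\mathbf Y}$ with $\mathbf{Supp}(t)=\mathbf f$. Moreover, if $\mathbf f$ is a coarse equivalence, $t$ may be chosen to be a unitary.
   Context: Relations. A relation from $X$ to $Y$ is a subset $R\subseteq Y\times X$; $R^{T}=\{(x,y):(y,x)\in R\}$; $R_2\circ R_1=\{(z,x):\exists y,\ (z,y)\in R_2,\ (y,x)\in R_1\}$; $R(A)=\{y:\exists a\in A,\ (y,a)\in R\}$. $B\subseteq Y$ and $A\subseteq X$ are $R$-separated if $B\cap R(A)=\emptyset$. $\Delta_X$ is the diagonal; $\pi_X,\pi_Y$ are the projections of $Y\times X$. Coarse spaces. A coarse structure on $X$ is a non-empty family $\mathcal E$ of subsets of $X\times X$ (controlled entourages), closed under subsets and finite unions, containing $\Delta_X$, and closed under $E\mapsto E^T$ and under composition; $\mathbf X=(X,\mathcal E)$ is a coarse space. A gauge is a symmetric element of $\mathcal E$ containing $\Delta_X$. $A\subseteq X$ is $E$-bounded if $A\times A\subseteq E$, and bounded if $A\times A\in\mathcal E$. For $A,B\subseteq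 X$ write $A\preccurlyeq B$ if $A\subseteq E(B)$ for some $E\in\mathcal E$, and $A\asymp B$ if $A\preccurlyeq B\preccurlyeq A$. $A$ is coarsely dense if $X\preccurlyeq A$. For relations $R,R'\subseteq Y\times X$: $R'\preccurlyeq R$ if $R'\subseteq F\circ R\circ E$ for some $F\in\mathcal F$, $E\in\mathcal E$ (this is $\preccurlyeq$ for the product coarse structure). A coarse subspace is an $\asymp$-class $[A]$; $[A]\subseteq[B]$ means $A\preccurlyeq B$. Coarse maps. $R\subseteq Y\times X$ is controlled if $R\circ E\circ R^T\in\mathcal F$ for all $E\in\mathcal E$. A partial coarse map from $\mathbf X$ to $\mathbf Y$ is the $\asymp$-class $\mathbf f=[R]$ of a controlled relation; it is a coarse map $\mathbf f\colon\mathbf X\to\mathbf Y$ if $\pi_X(R)$ is coarsely dense in $X$. A coarse map can be represented by (the relation $\{(f(x),x)\}$ of) a function $f\colon X\to Y$; composition of coarse maps is the class of the composition of representing functions. $\mathbf f$ is a coarse equivalence if there is a coarse map $\mathbf g\colon\mathbf Y\to\mathbf X$ with $\mathbf f\circ\mathbf g=[\Delta_Y]$, $\mathbf g\circ\mathbf f=[\Delta_X]$. Modules. An $\mathbf X$-module consists of a Boolean algebra $\mathfrak A$ of subsets of $X$ with $X\in\mathfrak A$ (its members are called measurable), a Hilbert space $\mathcal H$, and a map $\mathbb 1_\bullet$ from $\mathfrak A$ to projections (self-adjoint idempotents) in $\mathcal B(\mathcal H)$ with $\mathbb 1_\emptyset=0$, $\mathbb 1_X=1$, $\mathbb 1_{A\cap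 B}=\mathbb 1_A\mathbb 1_B$, $\mathbb 1_{A\cup B}=\mathbb 1_A+\mathbb 1_B-\mathbb 1_A\mathbb 1_B$, which is non-degenerate: for some gauge $\widetilde E$ the subspaces $\mathbb 1_A(\mathcal H)$ with $A$ measurable and $\widetilde E$-bounded span a dense subspace. It is faithful if for some gauge $\widetilde E$ the union of all measurable $\widetilde E$-bounded $A$ with $\mathbb 1_A\neq0$ is coarsely dense; it is $\kappa$-ample if moreover $\mathbb 1_A$ has rank at least $\kappa$ for each such $A$. The rank of a Hilbert space (or module) is the cardinality of an orthonormal basis. The module is discrete if there are a gauge $\widetilde E$ and a partition $X=\bigsqcup_{i\in I}A_i$ into measurable $\widetilde E$-bounded sets with $\sum_i\mathbb 1_{A_i}=1$ strongly, and such that every $C\subseteq X$ with $C\cap A_i\in\mathfrak A$ for all $i$ is in $\mathfrak A$. Operators (bounded) $t\colon\mathcal H_{\mathbf X}\to\mathcal H_{\mathbf Y}$. For $S\subseteq Y\times X$ write $\mathrm{Supp}(t)\subseteq S$ if $\mathbb 1_Bt\mathbb 1_A=0$ for all $S$-separated measurable $B\subseteq Y$, $A\subseteq X$. The coarse support $\mathbf{Supp}(t)$ is the (unique, always existing) coarse subspace $[S]$ such that $\mathrm{Supp}(t)\subseteq S$ and $S\preccurlyeq R$ whenever $\mathrm{Supp}(t)\subseteq R$. $t$ is controlled if $\mathbf{Supp}(t)$ is a partial coarse map. *)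

theory Defs
  imports "HOL-Analysis.Analysis"
begin

unbundle cardinal_syntax

section \<open>Complex Hilbert spaces\<close>

text \<open>
  The distribution only has real inner product spaces.  A complex Hilbert space is rendered as a
  real one (with the real part of the complex inner product) together with its
  complex structure; this keeps the library's norm, topology and infinite sums available.
  The complex inner product is linear in the first argument.
\<close>

class complex_hilbert_space = banach + real_inner +
  fixes scaleC :: "complex \<Rightarrow> 'a \<Rightarrow> 'a" (infixr \<open>*\<^sub>C\<close> 75)
    and cinner :: "'a \<Rightarrow> 'a \<Rightarrow> complex"
  assumes scaleR_scaleC: "r *\<^sub>R x = complex_of_real r *\<^sub>C x"
    and scaleC_add_right: "a *\<^sub>C (x + y) = a *\<^sub>C x + a *\<^sub>C y"
    and scaleC_add_left: "(a + b) *\<^sub>C x = a *\<^sub>C x + b *\<^sub>C x"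
    and scaleC_scaleC: "a *\<^sub>C (b *\<^sub>C x) = (a * b) *\<^sub>C x"
    and cinner_commute: "cinner x y = cnj (cinner y x)"
    and cinner_add_left: "cinner (x + y) z = cinner x z + cinner y z"
    and cinner_scaleC_left: "cinner (a *\<^sub>C x) y = a * cinner x y"
    and Re_cinner: "Re (cinner x y) = inner x y"

instantiation complex :: complex_hilbert_space
begin

definition scaleC_complex :: "complex \<Rightarrow> complex \<Rightarrow> complex"
  where "scaleC_complex a x = a * x"

definition cinner_complex :: "complex \<Rightarrow> complex \<Rightarrow> complex"
  where "cinner_complex x y = x * cnj y"

instance
  by standard (auto simp: scaleC_complex_def cinner_complex_def scaleR_conv_of_real
      algebra_simps inner_complex_def)

end

global_interpretation complex_vector:
  vector_space "scaleC :: complex \<Rightarrow> 'a \<Rightarrow> 'a::complex_hilbert_space"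
proof
  fix x :: 'a
  show "1 *\<^sub>C x = x"
    using scaleR_scaleC[of 1 x] by simp
qed (simp_all add: scaleC_add_right scaleC_add_left scaleC_scaleC)

definition bounded_operator ::
  "('h::complex_hilbert_space \<Rightarrow> 'g::complex_hilbert_space) \<Rightarrow> bool" where
  "bounded_operator t \<longleftrightarrow> bounded_linear t \<and> (\<forall>c v. t (c *\<^sub>C v) = c *\<^sub>C t v)"

definition projection_operator :: "('h::complex_hilbert_space \<Rightarrow> 'h) \<Rightarrow> bool" where
  "projection_operator p \<longleftrightarrow>
     bounded_operator p \<and> (\<forall>v. p (p v) = p v) \<and> (\<forall>v w. cinner (p v) w = cinner v (p w))"

definition isometry_operator ::
  "('h::complex_hilbert_space \<Rightarrow> 'g::complex_hilbert_space) \<Rightarrow> bool" where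
  "isometry_operator t \<longleftrightarrow> bounded_operator t \<and> (\<forall>v. norm (t v) = norm v)"

definition unitary_operator ::
  "('h::complex_hilbert_space \<Rightarrow> 'g::complex_hilbert_space) \<Rightarrow> bool" where
  "unitary_operator t \<longleftrightarrow> isometry_operator t \<and> surj t"

text \<open>Orthonormal bases (in the Hilbert space sense) of a closed subspace.\<close>

definition orthonormal_basis :: "'h::complex_hilbert_space set \<Rightarrow> 'h set \<Rightarrow> bool" where
  "orthonormal_basis B V \<longleftrightarrow>
     (\<forall>b\<in>B. \<forall>c\<in>B. cinner b c = (if b = c then 1 else 0)) \<and>
     closure (complex_vector.span B) = V"

text \<open>
  A cardinal is a relation \<open>\<kappa>\<close> with \<open>Card_order \<kappa>\<close>, over an arbitrary type.
\<close>

definition has_rank :: "'h::complex_hilbert_space set \<Rightarrow> 'k rel \<Rightarrow> bool" where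
  "has_rank V \<kappa> \<longleftrightarrow> (\<exists>B. orthonormal_basis B V \<and> |B| =o \<kappa>)"

definition rank_at_least :: "'k rel \<Rightarrow> 'h::complex_hilbert_space set \<Rightarrow> bool" where
  "rank_at_least \<kappa> V \<longleftrightarrow> (\<exists>B. orthonormal_basis B V \<and> \<kappa> \<le>o |B| )"


section \<open>Coarse spaces\<close>

text \<open>
  Relations from \<open>X\<close> to \<open>Y\<close> are subsets of \<open>Y \<times> X\<close>, target coordinate first.  With this
  orientation composition is \<^const>\<open>relcomp\<close> in the written order, but the image of a
  set has to be taken under the converse.
\<close>

abbreviation rel_image :: "('y \<times> 'x) set \<Rightarrow> 'x set \<Rightarrow> 'y set" where
  "rel_image R A \<equiv> R\<inverse> `` A"

record 'x coarse =
  points :: "'x set"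
  entourages :: "('x \<times> 'x) set set"

locale coarse_space =
  fixes X :: "'x coarse"
  assumes entourage_subset: "E \<in> entourages X \<Longrightarrow> E \<subseteq> points X \<times> points X"
    and entourage_diagonal: "Id_on (points X) \<in> entourages X"
    and entourage_mono: "E \<in> entourages X \<Longrightarrow> D \<subseteq> E \<Longrightarrow> D \<in> entourages X"
    and entourage_Un: "D \<in> entourages X \<Longrightarrow> E \<in> entourages X \<Longrightarrow> D \<union> E \<in> entourages X"
    and entourage_converse: "E \<in> entourages X \<Longrightarrow> E\<inverse> \<in> entourages X"
    and entourage_comp: "D \<in> entourages X \<Longrightarrow> E \<in> entourages X \<Longrightarrow> D O E \<in> entourages X"

definition gauge :: "'x coarse \<Rightarrow> ('x \<times> 'x) set \<Rightarrow> bool" where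
  "gauge X E \<longleftrightarrow> E \<in> entourages X \<and> sym E \<and> Id_on (points X) \<subseteq> E"

definition bounded_by :: "('x \<times> 'x) set \<Rightarrow> 'x set \<Rightarrow> bool" where
  "bounded_by E A \<longleftrightarrow> A \<times> A \<subseteq> E"

definition set_coarse_le :: "'x coarse \<Rightarrow> 'x set \<Rightarrow> 'x set \<Rightarrow> bool" where
  "set_coarse_le X A B \<longleftrightarrow> (\<exists>E\<in>entourages X. A \<subseteq> rel_image E B)"

definition coarsely_dense :: "'x coarse \<Rightarrow> 'x set \<Rightarrow> bool" where
  "coarsely_dense X A \<longleftrightarrow> set_coarse_le X (points X) A"

definition rel_coarse_le ::
  "'x coarse \<Rightarrow> 'y coarse \<Rightarrow> ('y \<times> 'x) set \<Rightarrow> ('y \<times> 'x) set \<Rightarrow> bool" where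
  "rel_coarse_le X Y R' R \<longleftrightarrow> (\<exists>F\<in>entourages Y. \<exists>E\<in>entourages X. R' \<subseteq> F O R O E)"

definition rel_class ::
  "'x coarse \<Rightarrow> 'y coarse \<Rightarrow> ('y \<times> 'x) set \<Rightarrow> ('y \<times> 'x) set set" where
  "rel_class X Y R =
     {R'. R' \<subseteq> points Y \<times> points X \<and> rel_coarse_le X Y R' R \<and> rel_coarse_le X Y R R'}"


section \<open>Coarse maps\<close>

definition controlled_relation ::
  "'x coarse \<Rightarrow> 'y coarse \<Rightarrow> ('y \<times> 'x) set \<Rightarrow> bool" where
  "controlled_relation X Y R \<longleftrightarrow>
     R \<subseteq> points Y \<times> points X \<and> (\<forall>E\<in>entourages X. R O E O R\<inverse> \<in> entourages Y)"

definition partial_coarse_map ::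
  "'x coarse \<Rightarrow> 'y coarse \<Rightarrow> ('y \<times> 'x) set set \<Rightarrow> bool" where
  "partial_coarse_map X Y f \<longleftrightarrow> (\<exists>R. controlled_relation X Y R \<and> f = rel_class X Y R)"

text \<open>By the orientation convention, the projection of a relation to \<open>X\<close> is its \<^const>\<open>Range\<close>.\<close>

definition coarse_map :: "'x coarse \<Rightarrow> 'y coarse \<Rightarrow> ('y \<times> 'x) set set \<Rightarrow> bool" where
  "coarse_map X Y f \<longleftrightarrow>
     (\<exists>R. controlled_relation X Y R \<and> coarsely_dense X (Range R) \<and> f = rel_class X Y R)"

definition graph_rel :: "'x coarse \<Rightarrow> ('x \<Rightarrow> 'y) \<Rightarrow> ('y \<times> 'x) set" where
  "graph_rel X \<phi> = {(\<phi> x, x) | x. x \<in> points X}"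

definition represents ::
  "'x coarse \<Rightarrow> 'y coarse \<Rightarrow> ('x \<Rightarrow> 'y) \<Rightarrow> ('y \<times> 'x) set set \<Rightarrow> bool" where
  "represents X Y \<phi> f \<longleftrightarrow> \<phi> \<in> points X \<rightarrow> points Y \<and> f = rel_class X Y (graph_rel X \<phi>)"

text \<open>
  For coarse maps the class below does not depend on the representing functions, so the
  comprehension over all of them denotes that one class.
\<close>

definition coarse_comp ::
  "'x coarse \<Rightarrow> 'y coarse \<Rightarrow> 'z coarse \<Rightarrow>
   ('z \<times> 'y) set set \<Rightarrow> ('y \<times> 'x) set set \<Rightarrow> ('z \<times> 'x) set set" where
  "coarse_comp X Y Z g f =
     {R. \<exists>\<phi> \<gamma>. represents X Y \<phi> f \<and> represents Y Z \<gamma> g \<and>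
               R \<in> rel_class X Z (graph_rel X (\<gamma> \<circ> \<phi>))}"

definition coarse_id :: "'x coarse \<Rightarrow> ('x \<times> 'x) set set" where
  "coarse_id X = rel_class X X (Id_on (points X))"

definition coarse_equivalence ::
  "'x coarse \<Rightarrow> 'y coarse \<Rightarrow> ('y \<times> 'x) set set \<Rightarrow> bool" where
  "coarse_equivalence X Y f \<longleftrightarrow>
     coarse_map X Y f \<and>
     (\<exists>g. coarse_map Y X g \<and>
          coarse_comp Y X Y f g = coarse_id Y \<and> coarse_comp X Y X g f = coarse_id X)"


section \<open>Modules over coarse spaces\<close>

text \<open>The Hilbert space of a module is the type \<open>'h\<close>.\<close>

record ('x, 'h) module_data =
  measurables :: "'x set set"
  proj :: "'x set \<Rightarrow> 'h \<Rightarrow> 'h"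

locale coarse_module =
  fixes X :: "'x coarse" and H :: "('x, 'h::complex_hilbert_space) module_data"
  assumes measurables_algebra: "algebra (points X) (measurables H)"
    and proj_projection: "A \<in> measurables H \<Longrightarrow> projection_operator (proj H A)"
    and proj_empty: "proj H {} v = 0"
    and proj_points: "proj H (points X) v = v"
    and proj_Int: "A \<in> measurables H \<Longrightarrow> B \<in> measurables H \<Longrightarrow>
          proj H (A \<inter> B) v = proj H A (proj H B v)"
    and proj_Un: "A \<in> measurables H \<Longrightarrow> B \<in> measurables H \<Longrightarrow>
          proj H (A \<union> B) v = proj H A v + proj H B v - proj H A (proj H B v)"
    and nondegenerate: "\<exists>E. gauge X E \<and>
          closure (complex_vector.span
            (\<Union>A\<in>{A \<in> measurables H. bounded_by E A}. range (proj H A))) = UNIV"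

definition nonzero_blocks ::
  "('x, 'h::complex_hilbert_space) module_data \<Rightarrow> ('x \<times> 'x) set \<Rightarrow> 'x set set" where
  "nonzero_blocks H E =
     {A \<in> measurables H. bounded_by E A \<and> proj H A \<noteq> (\<lambda>v. 0)}"

text \<open>Ampleness includes faithfulness, with respect to the same gauge.\<close>

definition ample_module ::
  "'k rel \<Rightarrow> 'x coarse \<Rightarrow> ('x, 'h::complex_hilbert_space) module_data \<Rightarrow> bool" where
  "ample_module \<kappa> X H \<longleftrightarrow>
     (\<exists>E. gauge X E \<and> coarsely_dense X (\<Union>(nonzero_blocks H E)) \<and>
          (\<forall>A\<in>nonzero_blocks H E. rank_at_least \<kappa> (range (proj H A))))"

definition module_has_rank ::
  "('x, 'h::complex_hilbert_space) module_data \<Rightarrow> 'k rel \<Rightarrow> bool" where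
  "module_has_rank H \<kappa> \<longleftrightarrow> has_rank (UNIV :: 'h set) \<kappa>"

definition discrete_module ::
  "'x coarse \<Rightarrow> ('x, 'h::complex_hilbert_space) module_data \<Rightarrow> bool" where
  "discrete_module X H \<longleftrightarrow>
     (\<exists>E P. gauge X E \<and> partition_on (points X) P \<and>
            (\<forall>A\<in>P. A \<in> measurables H \<and> bounded_by E A) \<and>
            (\<forall>v. ((\<lambda>A. proj H A v) has_sum v) P) \<and>
            (\<forall>C. C \<subseteq> points X \<and> (\<forall>A\<in>P. C \<inter> A \<in> measurables H) \<longrightarrow> C \<in> measurables H))"


section \<open>Coarse support\<close>

definition separated :: "('y \<times> 'x) set \<Rightarrow> 'y set \<Rightarrow> 'x set \<Rightarrow> bool" where
  "separated R B A \<longleftrightarrow> B \<inter> rel_image R A = {}"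

definition supp_subset ::
  "('x, 'h::complex_hilbert_space) module_data \<Rightarrow> ('y, 'g::complex_hilbert_space) module_data \<Rightarrow>
   ('h \<Rightarrow> 'g) \<Rightarrow> ('y \<times> 'x) set \<Rightarrow> bool" where
  "supp_subset HX HY t S \<longleftrightarrow>
     (\<forall>B\<in>measurables HY. \<forall>A\<in>measurables HX.
        separated S B A \<longrightarrow> (\<forall>v. proj HY B (t (proj HX A v)) = 0))"

definition least_support ::
  "'x coarse \<Rightarrow> ('x, 'h::complex_hilbert_space) module_data \<Rightarrow>
   'y coarse \<Rightarrow> ('y, 'g::complex_hilbert_space) module_data \<Rightarrow>
   ('h \<Rightarrow> 'g) \<Rightarrow> ('y \<times> 'x) set \<Rightarrow> bool" where
  "least_support X HX Y HY t S \<longleftrightarrow>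
     S \<subseteq> points Y \<times> points X \<and> supp_subset HX HY t S \<and>
     (\<forall>R. R \<subseteq> points Y \<times> points X \<and> supp_subset HX HY t R \<longrightarrow> rel_coarse_le X Y S R)"

definition coarse_support ::
  "'x coarse \<Rightarrow> ('x, 'h::complex_hilbert_space) module_data \<Rightarrow>
   'y coarse \<Rightarrow> ('y, 'g::complex_hilbert_space) module_data \<Rightarrow>
   ('h \<Rightarrow> 'g) \<Rightarrow> ('y \<times> 'x) set set" where
  "coarse_support X HX Y HY t =
     (THE s. \<exists>S. least_support X HX Y HY t S \<and> s = rel_class X Y S)"

lemma rel_coarse_le_trans:
  assumes "coarse_space X" "coarse_space Y"
    and "rel_coarse_le X Y R S" "rel_coarse_le X Y S T"
  shows "rel_coarse_le X Y R T"
proof -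
  obtain F E where FE: "F \<in> entourages Y" "E \<in> entourages X" "R \<subseteq> F O S O E"
    using assms(3) unfolding rel_coarse_le_def by blast
  obtain F' E' where FE': "F' \<in> entourages Y" "E' \<in> entourages X" "S \<subseteq> F' O T O E'"
    using assms(4) unfolding rel_coarse_le_def by blast
  have "R \<subseteq> (F O F') O T O (E' O E)"
    using FE(3) FE'(3) by blast
  moreover have "F O F' \<in> entourages Y" "E' O E \<in> entourages X"
    using coarse_space.entourage_comp assms(1,2) FE FE' by blast+
  ultimately show ?thesis
    unfolding rel_coarse_le_def by blast
qed

lemma coarse_support_eqI:
  assumes X: "coarse_space X" and Y: "coarse_space Y" and S: "least_support X HX Y HY t S"
  shows "coarse_support X HX Y HY t = rel_class X Y S"
  unfolding coarse_support_def
proof (rule the_equality)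
  show "\<exists>S'. least_support X HX Y HY t S' \<and> rel_class X Y S = rel_class X Y S'"
    using S by blast
next
  fix s assume "\<exists>S'. least_support X HX Y HY t S' \<and> s = rel_class X Y S'"
  then obtain S' where S': "least_support X HX Y HY t S'" and s: "s = rel_class X Y S'"
    by blast
  have "rel_coarse_le X Y S S'" "rel_coarse_le X Y S' S"
    using S S' unfolding least_support_def by blast+
  then show "s = rel_class X Y S"
    unfolding s rel_class_def using rel_coarse_le_trans[OF X Y] by blast
qed

definition controlled_operator ::
  "'x coarse \<Rightarrow> ('x, 'h::complex_hilbert_space) module_data \<Rightarrow>
   'y coarse \<Rightarrow> ('y, 'g::complex_hilbert_space) module_data \<Rightarrow>
   ('h \<Rightarrow> 'g) \<Rightarrow> bool" where
  "controlled_operator X HX Y HY t \<longleftrightarrow>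
     bounded_operator t \<and> partial_coarse_map X Y (coarse_support X HX Y HY t)"

end

theory Submission
  imports Defs "HOL-Library.Countable_Set_Type"
begin

text \<open>
  Choose orthonormal bases \<open>B\<close> and \<open>D\<close> of the two modules adapted to the discrete partitions.
  Blocks carrying at least \<open>\<kappa>\<close> basis vectors are coarsely dense by ampleness, while \<open>B\<close> and \<open>D\<close>
  themselves have at most \<open>\<kappa>\<close> elements.  Hence every basis vector of \<open>B\<close> can be sent to some large
  block close to its image under \<open>f\<close>, with all of \<open>B\<close> fitting into each large block, so that the
  assignment can be made injective; it extends to an isometry with coarse support \<open>f\<close>.  If \<open>f\<close> is
  a coarse equivalence there is also an injection \<open>D \<rightarrow> B\<close> close to the inverse, and the
  Schroeder--Bernstein bijection, being pointwise one of the two injections, is still close to \<open>f\<close>.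
\<close>

section \<open>Orthonormal families\<close>

lemma cinner_scaleC_right: "cinner x (a *\<^sub>C y) = cnj a * cinner x y"
  by (metis cinner_commute cinner_scaleC_left complex_cnj_mult)

text \<open>Conjugate-linearity in the second argument makes the imaginary part a real inner product
  with \<open>\<i> *\<^sub>C y\<close>; continuity of \<open>cinner\<close> is thus inherited from
  \<open>inner\<close>.\<close>

lemma cinner_eq_Complex:
  "cinner x y = Complex (inner x y) (inner x (\<i> *\<^sub>C y))"
  by (rule complex_eqI)
    (simp_all add: Re_cinner[symmetric] cinner_scaleC_right)

lemma cinner_self: "cinner x x = complex_of_real ((norm x)\<^sup>2)"
proof (rule complex_eqI)
  show "Im (cinner x x) = Im (complex_of_real ((norm x)\<^sup>2))"
    using arg_cong[OF cinner_commute[of x x], of Im] by simp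
qed (simp add: Re_cinner power2_norm_eq_inner)

lemma norm_scaleC: "norm (a *\<^sub>C x) = cmod a * norm x"
proof -
  have "complex_of_real ((norm (a *\<^sub>C x))\<^sup>2) = complex_of_real ((cmod a * norm x)\<^sup>2)"
    unfolding cinner_self[symmetric] cinner_scaleC_left cinner_scaleC_right power_mult_distrib
    by (simp add: cinner_self mult.assoc[symmetric] mult.commute[of "cnj a"] flip: complex_norm_square)
  then show ?thesis
    unfolding of_real_eq_iff by (simp add: power2_eq_iff_nonneg)
qed

lemma bounded_linear_cinner_left: "bounded_linear (\<lambda>x. cinner x y)"
proof -
  have "bounded_linear
      (\<lambda>x. complex_of_real (inner x y) + \<i> * complex_of_real (inner x (\<i> *\<^sub>C y)))"
    by (intro bounded_linear_add bounded_linear_compose[OF bounded_linear_of_real]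
        bounded_linear_compose[OF bounded_linear_mult_right] bounded_linear_inner_left)
  then show ?thesis
    by (simp add: cinner_eq_Complex Complex_eq)
qed

lemma bounded_linear_scaleC_right: "bounded_linear (\<lambda>x. a *\<^sub>C x)"
  by (rule bounded_linear_intro[where K = "cmod a"])
    (simp_all add: scaleC_add_right scaleR_scaleC scaleC_scaleC norm_scaleC mult.commute)

lemmas cinner_zero_left [simp] = linear_0[OF bounded_linear.linear[OF bounded_linear_cinner_left]]
lemmas cinner_diff_left = linear_diff[OF bounded_linear.linear[OF bounded_linear_cinner_left]]
lemmas cinner_sum_left = linear_sum[OF bounded_linear.linear[OF bounded_linear_cinner_left]]

lemma cinner_zero_right [simp]: "cinner x 0 = 0"
  by (metis cinner_commute cinner_zero_left complex_cnj_zero)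

lemma cinner_eq_zero_commute: "cinner x y = 0 \<longleftrightarrow> cinner y x = 0"
  by (metis cinner_commute complex_cnj_zero)

lemma cmod_cinner_commute: "cmod (cinner x y) = cmod (cinner y x)"
  by (metis cinner_commute complex_mod_cnj)

lemma cinner_self_eq_zero: "cinner x x = 0 \<longleftrightarrow> x = 0"
  by (simp add: cinner_self)

section \<open>Orthonormal families: Pythagoras, Bessel, expansions and Parseval\<close>

definition orthonormal_family :: "('i \<Rightarrow> 'h::complex_hilbert_space) \<Rightarrow> 'i set \<Rightarrow> bool" where
  "orthonormal_family e B \<longleftrightarrow> (\<forall>b\<in>B. \<forall>c\<in>B. cinner (e b) (e c) = (if b = c then 1 else 0))"

abbreviation orthonormal :: "'h::complex_hilbert_space set \<Rightarrow> bool" where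
  "orthonormal \<equiv> orthonormal_family (\<lambda>b. b)"

text \<open>Totality is phrased as triviality of the orthogonal complement, a condition that can be
  checked block by block and that directly kills the error term of an expansion.\<close>

definition total_family :: "('i \<Rightarrow> 'h::complex_hilbert_space) \<Rightarrow> 'i set \<Rightarrow> bool" where
  "total_family e B \<longleftrightarrow> (\<forall>w. (\<forall>b\<in>B. cinner w (e b) = 0) \<longrightarrow> w = 0)"

abbreviation total :: "'h::complex_hilbert_space set \<Rightarrow> bool" where
  "total \<equiv> total_family (\<lambda>b. b)"

text \<open>This is the reason for indexing families: an injection of one basis into another is
  itself an orthonormal family over the first.\<close>

lemma orthonormal_family_inj_on:
  assumes "orthonormal D" "inj_on j B" "j ` B \<subseteq> D"
  shows "orthonormal_family j B"
  using assms unfolding orthonormal_family_def inj_on_def image_subset_iff by auto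

lemma total_family_image: "total (j ` B) \<Longrightarrow> total_family j B"
  unfolding total_family_def by blast

lemma norm_orthonormal:
  assumes "orthonormal_family e B" "b \<in> B"
  shows "norm (e b) = 1"
proof -
  have "complex_of_real ((norm (e b))\<^sup>2) = 1"
    using assms unfolding orthonormal_family_def cinner_self[symmetric] by simp
  then have "(norm (e b))\<^sup>2 = 1"
    using of_real_eq_1_iff by blast
  then show ?thesis
    by (simp add: power2_eq_1_iff) (smt (verit) norm_ge_zero)
qed

lemma cinner_orthonormal_sum:
  assumes "orthonormal_family e B" "F \<subseteq> B" "finite F" "b \<in> B"
  shows "cinner (\<Sum>x\<in>F. a x *\<^sub>C e x) (e b) = (if b \<in> F then a b else 0)"
proof -
  have "cinner (\<Sum>x\<in>F. a x *\<^sub>C e x) (e b) = (\<Sum>x\<in>F. if b = x then a x else 0)"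
    unfolding cinner_sum_left cinner_scaleC_left
    using assms by (intro sum.cong) (auto simp: orthonormal_family_def)
  then show ?thesis
    using \<open>finite F\<close> by simp
qed

lemma norm_orthonormal_sum:
  assumes "orthonormal_family e B" "F \<subseteq> B" "finite F"
  shows "(norm (\<Sum>x\<in>F. a x *\<^sub>C e x))\<^sup>2 = (\<Sum>x\<in>F. (cmod (a x))\<^sup>2)"
proof -
  let ?s = "\<Sum>x\<in>F. a x *\<^sub>C e x"
  \<comment> \<open>The squared norm is real, so conjugating it is harmless; it turns each
    \<open>cinner (e x) ?s\<close> into \<open>cinner ?s (e x)\<close>, the form that
    \<open>cinner_orthonormal_sum\<close> evaluates.\<close>
  have "cnj (complex_of_real ((norm ?s)\<^sup>2)) = (\<Sum>x\<in>F. cnj (a x * cinner (e x) ?s))"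
    unfolding cinner_self[symmetric]
    by (subst (1) cinner_sum_left) (simp add: cinner_scaleC_left)
  also have "\<dots> = (\<Sum>x\<in>F. cnj (a x) * cinner ?s (e x))"
    by (metis (no_types, lifting) cinner_commute complex_cnj_mult)
  also have "\<dots> = (\<Sum>x\<in>F. complex_of_real ((cmod (a x))\<^sup>2))"
  proof (rule sum.cong[OF refl])
    fix x assume "x \<in> F"
    then show "cnj (a x) * cinner ?s (e x) = complex_of_real ((cmod (a x))\<^sup>2)"
      using assms cinner_orthonormal_sum[OF assms, of x a]
      by (simp add: subset_iff mult.commute flip: complex_norm_square)
  qed
  finally have "complex_of_real ((norm ?s)\<^sup>2) = complex_of_real (\<Sum>x\<in>F. (cmod (a x))\<^sup>2)"
    by simp
  then show ?thesis
    unfolding of_real_eq_iff .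
qed

text \<open>For the partial expansion \<open>s\<close>, both \<open>inner s v\<close> and the
  squared norm of \<open>s\<close> equal the sum of squared coefficients; expanding the squared norm
  of \<open>v - s\<close>, which is nonnegative, gives the bound.\<close>

lemma bessel_inequality:
  assumes "orthonormal_family e B" "F \<subseteq> B" "finite F"
  shows "(\<Sum>b\<in>F. (cmod (cinner v (e b)))\<^sup>2) \<le> (norm v)\<^sup>2"
proof -
  define s where "s = (\<Sum>b\<in>F. cinner v (e b) *\<^sub>C e b)"
  have "cinner s v = (\<Sum>b\<in>F. cinner v (e b) * cinner (e b) v)"
    unfolding s_def cinner_sum_left cinner_scaleC_left ..
  also have "\<dots> = (\<Sum>b\<in>F. complex_of_real ((cmod (cinner v (e b)))\<^sup>2))"
    by (intro sum.cong refl) (metis cinner_commute complex_norm_square)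
  finally have "inner s v = (\<Sum>b\<in>F. (cmod (cinner v (e b)))\<^sup>2)"
    unfolding Re_cinner[symmetric] by simp
  moreover have "(norm s)\<^sup>2 = (\<Sum>b\<in>F. (cmod (cinner v (e b)))\<^sup>2)"
    unfolding s_def by (rule norm_orthonormal_sum[OF assms])
  moreover have "0 \<le> (norm (v - s))\<^sup>2"
    by simp
  then have "0 \<le> (norm v)\<^sup>2 + (norm s)\<^sup>2 - 2 * inner s v"
    by (simp add: power2_norm_eq_inner inner_diff_left inner_diff_right inner_commute)
  ultimately show ?thesis
    by simp
qed

lemma bessel_summable:
  assumes "orthonormal_family e B"
  shows "(\<lambda>b. (cmod (cinner v (e b)))\<^sup>2) summable_on B"
  by (rule nonneg_bdd_above_summable_on)
    (use bessel_inequality[OF assms] in \<open>auto intro!: bdd_aboveI2[where M = "(norm v)\<^sup>2"]\<close>)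

text \<open>By Pythagoras the norm of a finite tail is the square root of a tail of the
  square-summable series. The finite partial sums are therefore Cauchy, and completeness gives the
  limit.\<close>

lemma orthonormal_summable:
  assumes on: "orthonormal_family e B" and "(\<lambda>b. (cmod (a b))\<^sup>2) summable_on B"
  shows "(\<lambda>b. a b *\<^sub>C e b) summable_on B"
proof -
  let ?f = "\<lambda>b. (cmod (a b))\<^sup>2" and ?g = "\<lambda>b. a b *\<^sub>C e b"
  obtain L where L: "(?f has_sum L) B"
    using assms(2) unfolding summable_on_def by blast
  have "\<exists>P. eventually P (finite_subsets_at_top B) \<and>
          (\<forall>F F'. P F \<and> P F' \<longrightarrow> dist (sum ?g F) (sum ?g F') < \<epsilon>)" if "\<epsilon> > 0" for \<epsilon>
  proof -
    have "(\<epsilon> / 3)\<^sup>2 > 0"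
      using that by simp
    \<comment> \<open>The accuracy is a square because tails are compared through squared norms; two
      tails of size at most \<open>\<epsilon> / 3\<close> then stay strictly below
      \<open>\<epsilon>\<close>.\<close>
    then obtain G where G: "finite G" "G \<subseteq> B" "dist (sum ?f G) L \<le> (\<epsilon> / 3)\<^sup>2"
      using has_sum_finite_approximation[OF L] by blast
    have tail: "norm (sum ?g (F - G)) \<le> \<epsilon> / 3" if F: "finite F" "G \<subseteq> F" "F \<subseteq> B" for F
    proof (rule power2_le_imp_le)
      have "sum ?f (F - G) = sum ?f F - sum ?f G"
        using F by (simp add: sum_diff)
      also have "\<dots> \<le> (\<epsilon> / 3)\<^sup>2"
        using finite_sum_le_has_sum[OF L, of F] F G(3) by (simp add: dist_real_def abs_if split: if_splits)
      finally show "(norm (sum ?g (F - G)))\<^sup>2 \<le> (\<epsilon> / 3)\<^sup>2"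
        using norm_orthonormal_sum[OF on, of "F - G" a] F by (simp add: subset_iff)
    qed (use that \<open>\<epsilon> > 0\<close> in simp)
    let ?P = "\<lambda>F. finite F \<and> G \<subseteq> F \<and> F \<subseteq> B"
    have "dist (sum ?g F) (sum ?g F') < \<epsilon>" if "?P F" "?P F'" for F F'
    proof -
      have "sum ?g F - sum ?g F' = sum ?g (F - G) - sum ?g (F' - G)"
        using that by (simp add: sum_diff)
      then have "dist (sum ?g F) (sum ?g F') \<le> norm (sum ?g (F - G)) + norm (sum ?g (F' - G))"
        by (simp add: dist_norm norm_triangle_ineq4)
      then show ?thesis
        using tail[of F] tail[of F'] that \<open>\<epsilon> > 0\<close> by auto
    qed
    moreover have "eventually ?P (finite_subsets_at_top B)"
      unfolding eventually_finite_subsets_at_top using G(1,2) by (intro exI[of _ G]) simp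
    ultimately show ?thesis
      by (intro exI[of _ ?P]) simp
  qed
  then have "cauchy_filter (filtermap (sum ?g) (finite_subsets_at_top B))"
    by (simp add: cauchy_filter_metric_filtermap)
  moreover have "complete (UNIV :: 'b set)"
    by (meson Cauchy_convergent UNIV_I complete_def convergent_def)
  ultimately obtain l where "(sum ?g \<longlongrightarrow> l) (finite_subsets_at_top B)"
    using complete_uniform[where S = UNIV] by (force simp: filterlim_def)
  then show ?thesis
    unfolding summable_on_def has_sum_def by blast
qed

lemma orthonormal_expansion_summable:
  assumes "orthonormal_family e B" "orthonormal_family e' B"
  shows "(\<lambda>b. cinner v (e b) *\<^sub>C e' b) summable_on B"
  using orthonormal_summable[OF assms(2) bessel_summable[OF assms(1)]] .

lemma cinner_orthonormal_infsum:
  assumes on: "orthonormal_family e B" and "(\<lambda>b. a b *\<^sub>C e b) summable_on B" "b \<in> B"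
  shows "cinner (\<Sum>\<^sub>\<infinity>x\<in>B. a x *\<^sub>C e x) (e b) = a b"
proof (rule has_sum_unique)
  show "((\<lambda>x. cinner (a x *\<^sub>C e x) (e b)) has_sum cinner (\<Sum>\<^sub>\<infinity>x\<in>B. a x *\<^sub>C e x) (e b)) B"
    using has_sum_bounded_linear[OF bounded_linear_cinner_left] assms(2) has_sum_infsum by blast
  show "((\<lambda>x. cinner (a x *\<^sub>C e x) (e b)) has_sum a b) B"
    using on \<open>b \<in> B\<close>
    by (intro has_sum_finite_neutralI[of "{b}"])
      (auto simp: orthonormal_family_def cinner_scaleC_left)
qed

text \<open>The expansion converges to a vector with the same coefficients as \<open>v\<close>; the
  difference is orthogonal to the whole family, so totality makes it vanish.\<close>

lemma total_orthonormal_expansion: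
  assumes "orthonormal_family e B" "total_family e B"
  shows "((\<lambda>b. cinner v (e b) *\<^sub>C e b) has_sum v) B"
proof -
  let ?g = "\<lambda>b. cinner v (e b) *\<^sub>C e b"
  have sum: "?g summable_on B"
    by (rule orthonormal_expansion_summable[OF assms(1,1)])
  have "cinner (v - infsum ?g B) (e b) = 0" if "b \<in> B" for b
    using cinner_orthonormal_infsum[OF assms(1) sum that] by (simp add: cinner_diff_left)
  then have "v - infsum ?g B = 0"
    using assms(2) unfolding total_family_def by blast
  then show ?thesis
    using has_sum_infsum[OF sum] by simp
qed

lemma parseval:
  assumes "orthonormal_family e B" "total_family e B"
  shows "((\<lambda>b. (cmod (cinner v (e b)))\<^sup>2) has_sum (norm v)\<^sup>2) B"
proof -
  have "((\<lambda>F. (norm (\<Sum>b\<in>F. cinner v (e b) *\<^sub>C e b))\<^sup>2) \<longlongrightarrow> (norm v)\<^sup>2)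
      (finite_subsets_at_top B)"
    using total_orthonormal_expansion[OF assms, of v] unfolding has_sum_def
    by (intro tendsto_power tendsto_norm)
  moreover have "\<forall>\<^sub>F F in finite_subsets_at_top B.
      (norm (\<Sum>b\<in>F. cinner v (e b) *\<^sub>C e b))\<^sup>2 = (\<Sum>b\<in>F. (cmod (cinner v (e b)))\<^sup>2)"
    by (intro eventually_finite_subsets_at_top_weakI norm_orthonormal_sum[OF assms(1)])
  ultimately show ?thesis
    unfolding has_sum_def by (rule Lim_transform_eventually)
qed

section \<open>Total sets and the cardinality of orthonormal sets\<close>

lemma total_if_dense_span:
  assumes "closure (complex_vector.span D) = UNIV"
  shows "total D"
  unfolding total_family_def
proof (intro allI impI)
  fix w :: 'a assume w: "\<forall>b\<in>D. cinner w b = 0"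
  have "cinner u w = 0" if "u \<in> complex_vector.span D" for u
    using that
  proof (induction rule: complex_vector.span_induct_alt)
    case (step a b y)
    have "cinner b w = 0"
      using w step(1) by (subst cinner_eq_zero_commute) blast
    then show ?case
      using step(2) by (simp add: cinner_add_left cinner_scaleC_left)
  qed simp
  then have "complex_vector.span D \<subseteq> {u. cinner u w = 0}"
    by blast
  moreover have "closed {u. cinner u w = 0}"
    by (intro closed_Collect_eq continuous_intros
        bounded_linear.continuous_on[OF bounded_linear_cinner_left])
  ultimately have "closure (complex_vector.span D) \<subseteq> {u. cinner u w = 0}"
    by (rule closure_minimal)
  then have "cinner w w = 0"
    using assms by blast
  then show "w = 0"
    by (simp add: cinner_self_eq_zero)
qed

text \<open>Double counting of the squared moduli of \<open>cinner b d\<close>: Parseval over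
  \<open>D\<close> makes the total \<open>card F\<close>, while Bessel over \<open>F\<close> bounds
  it by \<open>card D\<close>.\<close>

lemma finite_orthonormal_bound:
  fixes B D :: "'h::complex_hilbert_space set"
  assumes B: "orthonormal B" and D: "orthonormal D" "total D" "finite D"
  shows "finite B \<and> card B \<le> card D"
proof (rule finite_if_finite_subsets_card_bdd)
  fix F assume F: "F \<subseteq> B" "finite F"
  have "real (card F) = (\<Sum>b\<in>F. (norm b)\<^sup>2)"
    using norm_orthonormal[OF B] F by (simp add: subset_iff)
  also have "\<dots> = (\<Sum>b\<in>F. \<Sum>d\<in>D. (cmod (cinner b d))\<^sup>2)"
    by (intro sum.cong refl has_sum_unique[OF parseval[OF D(1,2)] has_sum_finite[OF D(3)]])
  also have "\<dots> = (\<Sum>d\<in>D. \<Sum>b\<in>F. (cmod (cinner d b))\<^sup>2)"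
    by (subst sum.swap) (simp add: cmod_cinner_commute)
  also have "\<dots> \<le> (\<Sum>d\<in>D. (norm d)\<^sup>2)"
    by (intro sum_mono bessel_inequality[OF B F])
  also have "\<dots> = real (card D)"
    using norm_orthonormal[OF D(1)] by simp
  finally show "card F \<le> card D"
    by simp
qed

text \<open>In the infinite case each \<open>b\<close> has a nonzero coefficient at some
  \<open>d\<close>, and by Bessel each \<open>d\<close> sees only countably many \<open>b\<close>.
  So \<open>B\<close> is covered by \<open>D\<close>-many countable sets.\<close>

lemma orthonormal_ordLeq_total:
  fixes B D :: "'h::complex_hilbert_space set"
  assumes B: "orthonormal B" and D: "orthonormal D" "total D"
  shows "|B| \<le>o |D|"
proof (cases "finite D")
  case True
  with finite_orthonormal_bound[OF B D True] show ?thesis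
    by (metis card_of_ordLeq inj_on_iff_card_le)
next
  case False
  have "B \<subseteq> (\<Union>d\<in>D. {b \<in> B. cinner d b \<noteq> 0})"
  proof
    fix b assume "b \<in> B"
    then have "b \<noteq> 0"
      using norm_orthonormal[OF B] by force
    then obtain d where "d \<in> D" "cinner b d \<noteq> 0"
      using D(2) unfolding total_family_def by blast
    then show "b \<in> (\<Union>d\<in>D. {b \<in> B. cinner d b \<noteq> 0})"
      using \<open>b \<in> B\<close> cinner_eq_zero_commute by blast
  qed
  then have "|B| \<le>o |\<Union>d\<in>D. {b \<in> B. cinner d b \<noteq> 0}|"
    by (rule card_of_mono1)
  also have "|\<Union>d\<in>D. {b \<in> B. cinner d b \<noteq> 0}| \<le>o |D|"
  proof (rule card_of_UNION_ordLeq_infinite[OF False card_of_mono1[OF subset_refl]], rule ballI)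
    fix d
    have "countable {b \<in> B. (cmod (cinner d b))\<^sup>2 \<noteq> 0}"
      by (rule summable_countable_real[OF bessel_summable[OF B]])
    then have "|{b \<in> B. cinner d b \<noteq> 0}| \<le>o |UNIV :: nat set|"
      by (simp add: countable_card_of_nat)
    also have "|UNIV :: nat set| \<le>o |D|"
      using False by (simp add: infinite_iff_card_of_nat)
    finally show "|{b \<in> B. cinner d b \<noteq> 0}| \<le>o |D|" .
  qed
  finally show ?thesis .
qed

text \<open>Zorn's lemma yields a maximal orthonormal set between \<open>B\<close> and
  \<open>V\<close>. \<open>V\<close> is an arbitrary set; closure under scaling is asked only of the
  vector \<open>w\<close>, so that it can be normalised inside \<open>V\<close>.\<close>

lemma orthonormal_extend:
  fixes B V :: "'h::complex_hilbert_space set"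
  assumes "orthonormal B" "B \<subseteq> V"
  obtains M where "orthonormal M" "B \<subseteq> M" "M \<subseteq> V"
    "\<And>w. w \<in> V \<Longrightarrow> (\<And>a. a *\<^sub>C w \<in> V) \<Longrightarrow> (\<forall>b\<in>M. cinner w b = 0) \<Longrightarrow> w = 0"
proof -
  let ?S = "{M. orthonormal M \<and> M \<subseteq> V \<and> B \<subseteq> M}"
  have "\<exists>M\<in>?S. \<forall>N\<in>?S. M \<subseteq> N \<longrightarrow> N = M"
  proof (rule subset_Zorn_nonempty)
    fix C assume C: "C \<noteq> {}" "subset.chain ?S C"
    have "orthonormal (\<Union>C)"
      unfolding orthonormal_family_def
    proof (intro ballI)
      fix b c assume "b \<in> \<Union>C" "c \<in> \<Union>C"
      then obtain M where "M \<in> C" "b \<in> M" "c \<in> M"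
        using C(2) unfolding subset_chain_def by (meson UnionE subsetD)
      then show "cinner b c = (if b = c then 1 else 0)"
        using C(2) unfolding subset_chain_def orthonormal_family_def by auto
    qed
    then show "\<Union>C \<in> ?S"
      using C unfolding subset_chain_def by auto
  qed (use assms in auto)
  then obtain M where "M \<in> ?S" and max': "\<forall>N\<in>?S. M \<subseteq> N \<longrightarrow> N = M" ..
  then have M: "orthonormal M" "M \<subseteq> V" "B \<subseteq> M"
    by simp_all
  have max: "N = M" if "orthonormal N" "N \<subseteq> V" "B \<subseteq> N" "M \<subseteq> N" for N
    using max' that by simp
  show thesis
  proof (rule that[OF M(1,3,2)], rule ccontr)
    fix w assume w: "w \<in> V" "\<And>a. a *\<^sub>C w \<in> V" "\<forall>b\<in>M. cinner w b = 0" "w \<noteq> 0"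
    \<comment> \<open>The normalised \<open>w\<close> could be added to \<open>M\<close>; maximality
      puts it in \<open>M\<close>, where it would be orthogonal to itself.\<close>
    define u where "u = complex_of_real (1 / norm w) *\<^sub>C w"
    have "cinner u u = 1"
      using w(4) unfolding cinner_self u_def norm_scaleC by (simp add: norm_divide)
    moreover have perp: "\<forall>b\<in>M. cinner u b = 0 \<and> cinner b u = 0"
      unfolding u_def cinner_scaleC_left cinner_scaleC_right
      by (simp add: w(3) cinner_eq_zero_commute[of _ w])
    ultimately have "orthonormal (insert u M)"
      using M(1) unfolding orthonormal_family_def by auto
    moreover have "u \<in> V"
      unfolding u_def by (rule w(2))
    ultimately have "u \<in> M"
      using max[of "insert u M"] M by blast
    with perp \<open>cinner u u = 1\<close> show False
      by simp
  qed
qed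

section \<open>Extending a map on a basis to an isometry or a unitary\<close>

definition basis_operator ::
  "'h::complex_hilbert_space set \<Rightarrow> ('h \<Rightarrow> 'g::complex_hilbert_space) \<Rightarrow> 'h \<Rightarrow> 'g" where
  "basis_operator B j v = (\<Sum>\<^sub>\<infinity>b\<in>B. cinner v b *\<^sub>C j b)"

context
  fixes B :: "'h::complex_hilbert_space set" and j :: "'h \<Rightarrow> 'g::complex_hilbert_space"
  assumes B: "orthonormal B" and total_B: "total B" and j: "orthonormal_family j B"
begin

text \<open>\<open>infsum\<close> defaults to zero on non-summable families; here Bessel for
  \<open>B\<close> and orthonormality of \<open>j\<close> ensure that the defining sum really
  converges.\<close>

lemma has_sum_basis_operator:
  "((\<lambda>b. cinner v b *\<^sub>C j b) has_sum basis_operator B j v) B"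
  unfolding basis_operator_def
  by (rule has_sum_infsum[OF orthonormal_expansion_summable[OF B j]])

lemma basis_operator_eqI:
  "((\<lambda>b. cinner v b *\<^sub>C j b) has_sum w) B \<Longrightarrow> basis_operator B j v = w"
  by (rule has_sum_unique[OF has_sum_basis_operator])

lemma basis_operator_basis:
  assumes "b \<in> B"
  shows "basis_operator B j b = j b"
proof (rule basis_operator_eqI, rule has_sum_finite_neutralI[of "{b}"])
  show "j b = (\<Sum>x\<in>{b}. cinner b x *\<^sub>C j x)"
    using B assms by (simp add: orthonormal_family_def)
qed (use B assms in \<open>auto simp: orthonormal_family_def\<close>)

text \<open>Image and argument have the same coefficients, with respect to \<open>j\<close> and to
  \<open>B\<close>, so passing to the limit in Pythagoras gives the Parseval sum of
  \<open>v\<close>.\<close>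

lemma norm_basis_operator: "norm (basis_operator B j v) = norm v"
proof -
  have "((\<lambda>F. (norm (\<Sum>b\<in>F. cinner v b *\<^sub>C j b))\<^sup>2) \<longlongrightarrow> (norm (basis_operator B j v))\<^sup>2)
      (finite_subsets_at_top B)"
    using has_sum_basis_operator unfolding has_sum_def
    by (intro tendsto_power tendsto_norm)
  moreover have "\<forall>\<^sub>F F in finite_subsets_at_top B.
      (norm (\<Sum>b\<in>F. cinner v b *\<^sub>C j b))\<^sup>2 = (\<Sum>b\<in>F. (cmod (cinner v b))\<^sup>2)"
    by (intro eventually_finite_subsets_at_top_weakI norm_orthonormal_sum[OF j])
  ultimately have "((\<lambda>b. (cmod (cinner v b))\<^sup>2) has_sum (norm (basis_operator B j v))\<^sup>2) B"
    unfolding has_sum_def by (rule Lim_transform_eventually)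
  from has_sum_unique[OF this parseval[OF B total_B]] show ?thesis
    by (simp add: power2_eq_iff_nonneg)
qed

lemma basis_operator_scaleC: "basis_operator B j (c *\<^sub>C v) = c *\<^sub>C basis_operator B j v"
proof (rule basis_operator_eqI)
  show "((\<lambda>b. cinner (c *\<^sub>C v) b *\<^sub>C j b) has_sum c *\<^sub>C basis_operator B j v) B"
    using has_sum_bounded_linear[OF bounded_linear_scaleC_right has_sum_basis_operator]
    by (simp add: cinner_scaleC_left scaleC_scaleC)
qed

lemma basis_operator_add:
  "basis_operator B j (v + w) = basis_operator B j v + basis_operator B j w"
proof (rule basis_operator_eqI)
  show "((\<lambda>b. cinner (v + w) b *\<^sub>C j b) has_sum basis_operator B j v + basis_operator B j w) B"
    using has_sum_add[OF has_sum_basis_operator has_sum_basis_operator]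
    by (simp add: cinner_add_left scaleC_add_left)
qed

lemma isometry_basis_operator: "isometry_operator (basis_operator B j)"
proof -
  have "bounded_linear (basis_operator B j)"
    by (rule bounded_linear_intro[where K = 1])
      (simp_all add: basis_operator_add scaleR_scaleC basis_operator_scaleC norm_basis_operator)
  then show ?thesis
    unfolding isometry_operator_def bounded_operator_def
    by (simp add: basis_operator_scaleC norm_basis_operator)
qed

lemma unitary_basis_operator:
  assumes "total_family j B"
  shows "unitary_operator (basis_operator B j)"
proof -
  have "w \<in> range (basis_operator B j)" for w
  proof -
    \<comment> \<open>The preimage of \<open>w\<close> carries at \<open>b\<close> the coefficient
      that \<open>w\<close> has at \<open>j b\<close>.\<close>
    let ?v = "\<Sum>\<^sub>\<infinity>b\<in>B. cinner w (j b) *\<^sub>C b"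
    have "cinner ?v b = cinner w (j b)" if "b \<in> B" for b
      by (rule cinner_orthonormal_infsum[OF B orthonormal_expansion_summable[OF j B] that])
    then have "((\<lambda>b. cinner ?v b *\<^sub>C j b) has_sum w) B \<longleftrightarrow>
        ((\<lambda>b. cinner w (j b) *\<^sub>C j b) has_sum w) B"
      by (intro has_sum_cong) simp
    then have "basis_operator B j ?v = w"
      using total_orthonormal_expansion[OF j assms] by (intro basis_operator_eqI) simp
    then show ?thesis
      by (metis rangeI)
  qed
  then show ?thesis
    unfolding unitary_operator_def using isometry_basis_operator by blast
qed

end

section \<open>Injections with prescribed labels\<close>

text \<open>Each \<open>b\<close> chooses an admissible label whose fibre has at least
  \<open>\<kappa>\<close> elements. Every such fibre has room for a copy of all of \<open>B\<close>,
  so it does not matter how many elements choose the same label.\<close>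

lemma fiberwise_injection:
  assumes "|B| \<le>o \<kappa>"
    and "\<And>b. b \<in> B \<Longrightarrow> \<exists>c\<in>D. Q b (A c) \<and> \<kappa> \<le>o |{d \<in> D. A d = A c}|"
  obtains j where "inj_on j B" "j ` B \<subseteq> D" "\<And>b. b \<in> B \<Longrightarrow> Q b (A (j b))"
proof -
  have "\<exists>L. Q b L \<and> \<kappa> \<le>o |{d \<in> D. A d = L}|" if "b \<in> B" for b
    using assms(2)[OF that] by blast
  then obtain L where L: "\<And>b. b \<in> B \<Longrightarrow> Q b (L b)"
      "\<And>b. b \<in> B \<Longrightarrow> \<kappa> \<le>o |{d \<in> D. A d = L b}|"
    by metis
  have "\<exists>i. inj_on i B \<and> i ` B \<subseteq> {d \<in> D. A d = l}" if "l \<in> L ` B" for l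
  proof -
    have "|B| \<le>o |{d \<in> D. A d = l}|"
      using that L(2) ordLeq_transitive[OF assms(1)] by blast
    then show ?thesis
      unfolding card_of_ordLeq[symmetric] .
  qed
  then obtain i where i: "\<And>l. l \<in> L ` B \<Longrightarrow> inj_on (i l) B"
      "\<And>l. l \<in> L ` B \<Longrightarrow> i l ` B \<subseteq> {d \<in> D. A d = l}"
    by metis
  have fib: "i (L b) b \<in> D \<and> A (i (L b) b) = L b" if "b \<in> B" for b
    using i(2)[of "L b"] that by blast
  \<comment> \<open>Distinct labels give distinct values because the fibres are disjoint; for equal
    labels the injection of that fibre separates the arguments.\<close>
  show thesis
  proof (rule that[of "\<lambda>b. i (L b) b"])
    show "inj_on (\<lambda>b. i (L b) b) B"
    proof (rule inj_onI)
      fix b c assume bc: "b \<in> B" "c \<in> B" "i (L b) b = i (L c) c"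
      then have "L b = L c"
        using fib by metis
      then show "b = c"
        using i(1)[of "L b"] bc by (auto dest: inj_onD)
    qed
  qed (use fib L(1) in auto)
qed

text \<open>Banach's decomposition: \<open>j\<close> is used on a fixed set \<open>S\<close> and the
  inverse of \<open>k\<close> off it. The pointwise alternative is kept in the conclusion because
  closeness to a coarse map is later read off from it.\<close>

lemma Schroeder_Bernstein_graph:
  assumes "inj_on j A" "j ` A \<subseteq> B" "inj_on k B" "k ` B \<subseteq> A"
  obtains h where "bij_betw h A B" "\<And>a. a \<in> A \<Longrightarrow> h a = j a \<or> k (h a) = a"
proof -
  \<comment> \<open>Two nested complements make the operator monotone. Its fixed point equation says
    that \<open>A - S\<close> is exactly the \<open>k\<close>-image of \<open>B\<close> minus the
    \<open>j\<close>-image of \<open>S\<close>.\<close>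
  define S where "S = lfp (\<lambda>S. A - k ` (B - j ` S))"
  have S: "S = A - k ` (B - j ` S)"
    unfolding S_def by (rule lfp_unfold) (intro monoI Diff_mono image_mono order_refl)
  define h where "h a = (if a \<in> S then j a else inv_into B k a)" for a
  have inv: "inv_into B k (k b) = b" if "b \<in> B" for b
    using assms(3) that by simp
  have h_compl: "h a \<in> B - j ` S \<and> k (h a) = a" if "a \<in> A - S" for a
  proof -
    have "a \<in> k ` (B - j ` S)"
      using that S by blast
    then show ?thesis
      using that inv unfolding h_def by auto
  qed
  show thesis
  proof (rule that[of h])
    have SA: "S \<subseteq> A"
      using S by blast
    have "inj_on h A"
    proof (rule inj_onI)
      fix a c assume ac: "a \<in> A" "c \<in> A" "h a = h c"
      consider "a \<in> S" "c \<in> S" | "a \<in> S" "c \<notin> S" | "a \<notin> S" "c \<in> S" | "a \<notin> S" "c \<notin> S"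
        by blast
      then show "a = c"
      proof cases
        case 1
        then show ?thesis
          using ac assms(1) by (auto simp: h_def dest: inj_onD)
      next
        case 2
        then show ?thesis
          using ac h_compl[of c] by (metis DiffD2 DiffI h_def imageI)
      next
        case 3
        then show ?thesis
          using ac h_compl[of a] by (metis DiffD2 DiffI h_def imageI)
      next
        case 4
        then show ?thesis
          using ac h_compl[of a] h_compl[of c] by (metis DiffI)
      qed
    qed
    moreover have "h ` A \<subseteq> B"
    proof
      fix b assume "b \<in> h ` A"
      then obtain a where "a \<in> A" "b = h a"
        by blast
      then show "b \<in> B"
        using h_compl[of a] assms(2) by (cases "a \<in> S") (auto simp: h_def)
    qed
    moreover have "B \<subseteq> h ` A"
    proof
      fix b assume b: "b \<in> B"
      show "b \<in> h ` A"
      proof (cases "b \<in> j ` S")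
        case True
        then obtain a where "a \<in> S" "b = j a"
          by blast
        then show ?thesis
          using SA by (intro image_eqI[of _ _ a]) (auto simp: h_def)
      next
        case False
        then have "k b \<in> A" "k b \<notin> S"
          using b S assms(4) by blast+
        then show ?thesis
          using inv[OF b] by (intro image_eqI[of _ _ "k b"]) (auto simp: h_def)
      qed
    qed
    ultimately show "bij_betw h A B"
      unfolding bij_betw_def by blast
    show "h a = j a \<or> k (h a) = a" if "a \<in> A" for a
      using h_compl[of a] that by (auto simp: h_def)
  qed
qed

section \<open>Bases adapted to a discrete module\<close>

lemma projection_operatorD:
  assumes "projection_operator p"
  shows "bounded_linear p" "p (c *\<^sub>C v) = c *\<^sub>C p v" "p (p v) = p v" "cinner (p v) w = cinner v (p w)"
  using assms unfolding projection_operator_def bounded_operator_def by auto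

text \<open>\<open>A b\<close> is the partition block containing the support of the basis vector \<open>b\<close>.\<close>

definition adapted_basis ::
  "'k rel \<Rightarrow> 'x coarse \<Rightarrow> ('x, 'h::complex_hilbert_space) module_data \<Rightarrow>
   ('x \<times> 'x) set \<Rightarrow> 'h set \<Rightarrow> ('h \<Rightarrow> 'x set) \<Rightarrow> bool" where
  "adapted_basis \<kappa> X H E B A \<longleftrightarrow>
     E \<in> entourages X \<and> orthonormal B \<and> total B \<and>
     (\<forall>b\<in>B. A b \<in> measurables H \<and> A b \<times> A b \<subseteq> E \<and> proj H (A b) b = b) \<and>
     (\<forall>x\<in>points X. \<exists>b\<in>B. {x} \<times> A b \<subseteq> E \<and> \<kappa> \<le>o |{c \<in> B. A c = A b}| )"

section \<open>Calculus of the module projections\<close>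

lemma (in coarse_module) measurable_Int:
  "A \<in> measurables H \<Longrightarrow> B \<in> measurables H \<Longrightarrow> A \<inter> B \<in> measurables H"
  using measurables_algebra unfolding algebra_iff_Int by blast

lemma (in coarse_module) measurable_subset: "A \<in> measurables H \<Longrightarrow> A \<subseteq> points X"
  using measurables_algebra unfolding algebra_iff_Un by blast

lemma (in coarse_module) proj_zero: "A \<in> measurables H \<Longrightarrow> proj H A 0 = 0"
  using projection_operatorD(1)[OF proj_projection] linear_0 bounded_linear.linear by blast

lemma (in coarse_module) proj_subset:
  assumes "A \<in> measurables H" "C \<in> measurables H" "A \<subseteq> C" "proj H A v = v"
  shows "proj H C v = v"
  using proj_Int[OF assms(2,1), of v] assms(3,4) by (simp add: Int_absorb1)

lemma (in coarse_module) proj_disjoint: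
  assumes "A \<in> measurables H" "C \<in> measurables H" "A \<inter> C = {}"
  shows "proj H A (proj H C v) = 0"
  using proj_Int[OF assms(1,2), of v] assms(3) by (simp add: proj_empty)

lemma (in coarse_module) cinner_proj:
  "A \<in> measurables H \<Longrightarrow> cinner (proj H A v) w = cinner v (proj H A w)"
  by (rule projection_operatorD(4)[OF proj_projection])

text \<open>Strong convergence applied to \<open>proj H C v\<close> decomposes it into its
  components on the sets \<open>A \<inter> C\<close>; if all of these vanished, so would
  \<open>proj H C\<close>.\<close>

lemma (in coarse_module) partition_meets_nonzero:
  assumes P: "\<And>A. A \<in> P \<Longrightarrow> A \<in> measurables H"
    and sum: "\<And>v. ((\<lambda>A. proj H A v) has_sum v) P"
    and C: "C \<in> measurables H" "proj H C \<noteq> (\<lambda>v. 0)"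
  obtains A where "A \<in> P" "proj H (A \<inter> C) \<noteq> (\<lambda>v. 0)"
proof (rule ccontr)
  assume "\<not> thesis"
  with that have 0: "\<And>A. A \<in> P \<Longrightarrow> proj H (A \<inter> C) = (\<lambda>v. 0)"
    by blast
  have "proj H C v = 0" for v
  proof (rule has_sum_unique[OF sum])
    show "((\<lambda>A. proj H A (proj H C v)) has_sum 0) P"
      using 0 by (intro has_sum_0) (simp add: proj_Int[OF P C(1), symmetric])
  qed
  with C(2) show False
    by blast
qed

text \<open>A maximal orthonormal set is taken in the range of each partition projection, and the
  union is a basis. Discreteness and ampleness come with different gauges; intersecting partition
  blocks with ample ones transfers largeness to the partition.\<close>

lemma (in coarse_module) adapted_basis_exists:
  assumes "coarse_space X" "discrete_module X H" "ample_module \<kappa> X H"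
  obtains E B A where "adapted_basis \<kappa> X H E B A"
proof -
  interpret coarse_space X by fact
  obtain E\<^sub>0 P where E\<^sub>0: "gauge X E\<^sub>0" and part: "partition_on (points X) P"
    and P: "\<And>A. A \<in> P \<Longrightarrow> A \<in> measurables H" "\<And>A. A \<in> P \<Longrightarrow> bounded_by E\<^sub>0 A"
    and sum: "\<And>v. ((\<lambda>A. proj H A v) has_sum v) P"
    using assms(2) unfolding discrete_module_def by blast
  obtain E\<^sub>1 where E\<^sub>1: "gauge X E\<^sub>1" and dense: "coarsely_dense X (\<Union>(nonzero_blocks H E\<^sub>1))"
    and ample: "\<And>A. A \<in> nonzero_blocks H E\<^sub>1 \<Longrightarrow> rank_at_least \<kappa> (range (proj H A))"
    using assms(3) unfolding ample_module_def by blast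
  obtain E\<^sub>2 where E\<^sub>2: "E\<^sub>2 \<in> entourages X" "points X \<subseteq> rel_image E\<^sub>2 (\<Union>(nonzero_blocks H E\<^sub>1))"
    using dense unfolding coarsely_dense_def set_coarse_le_def by blast
  let ?V = "\<lambda>A. {v. proj H A v = v}"
  \<comment> \<open>The last clause makes \<open>M\<close> have at least \<open>\<kappa>\<close>
    elements whenever some orthonormal set in the block does: \<open>M\<close> extends such a set if
    there is one, and otherwise extends the empty set, the clause being vacuous.\<close>
  have "\<exists>M. orthonormal M \<and> M \<subseteq> ?V A \<and> (\<forall>w\<in>?V A. (\<forall>b\<in>M. cinner w b = 0) \<longrightarrow> w = 0) \<and>
      (\<forall>S. orthonormal S \<and> S \<subseteq> ?V A \<and> \<kappa> \<le>o |S| \<longrightarrow> \<kappa> \<le>o |M| )" if "A \<in> P" for A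
  proof -
    have scale: "a *\<^sub>C w \<in> ?V A" if "w \<in> ?V A" for a w
      using that projection_operatorD(2)[OF proj_projection[OF P(1)[OF \<open>A \<in> P\<close>]]] by simp
    obtain S where S: "orthonormal S" "S \<subseteq> ?V A"
      "\<forall>S'. orthonormal S' \<and> S' \<subseteq> ?V A \<and> \<kappa> \<le>o |S'| \<longrightarrow> \<kappa> \<le>o |S|"
    proof (cases "\<exists>S. orthonormal S \<and> S \<subseteq> ?V A \<and> \<kappa> \<le>o |S|")
      case True
      then show ?thesis
        using that by blast
    next
      case False
      have "orthonormal {}"
        by (simp add: orthonormal_family_def)
      then show ?thesis
        using that[of "{}"] False by blast
    qed
    obtain M where M: "orthonormal M" "S \<subseteq> M" "M \<subseteq> ?V A"
      "\<And>w. w \<in> ?V A \<Longrightarrow> (\<And>a. a *\<^sub>C w \<in> ?V A) \<Longrightarrow> (\<forall>b\<in>M. cinner w b = 0) \<Longrightarrow> w = 0"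
      using orthonormal_extend[OF S(1,2)] by blast
    have "\<kappa> \<le>o |M|" if "\<kappa> \<le>o |S|"
      using ordLeq_transitive[OF that card_of_mono1[OF M(2)]] .
    then have "\<forall>S'. orthonormal S' \<and> S' \<subseteq> ?V A \<and> \<kappa> \<le>o |S'| \<longrightarrow> \<kappa> \<le>o |M|"
      using S(3) by blast
    moreover have "\<forall>w\<in>?V A. (\<forall>b\<in>M. cinner w b = 0) \<longrightarrow> w = 0"
      using M(4)[OF _ scale] by blast
    ultimately show ?thesis
      using M(1,3) by (intro exI[of _ M] conjI)
  qed
  then have "\<forall>A\<in>P. \<exists>M. orthonormal M \<and> M \<subseteq> ?V A \<and>
      (\<forall>w\<in>?V A. (\<forall>b\<in>M. cinner w b = 0) \<longrightarrow> w = 0) \<and>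
      (\<forall>S. orthonormal S \<and> S \<subseteq> ?V A \<and> \<kappa> \<le>o |S| \<longrightarrow> \<kappa> \<le>o |M| )" ..
  from bchoice[OF this] obtain M where M':
    "\<forall>A\<in>P. orthonormal (M A) \<and> M A \<subseteq> ?V A \<and>
      (\<forall>w\<in>?V A. (\<forall>b\<in>M A. cinner w b = 0) \<longrightarrow> w = 0) \<and>
      (\<forall>S. orthonormal S \<and> S \<subseteq> ?V A \<and> \<kappa> \<le>o |S| \<longrightarrow> \<kappa> \<le>o |M A| )" ..
  have M: "\<And>A. A \<in> P \<Longrightarrow> orthonormal (M A)" "\<And>A. A \<in> P \<Longrightarrow> M A \<subseteq> ?V A"
    "\<And>A w. A \<in> P \<Longrightarrow> w \<in> ?V A \<Longrightarrow> (\<forall>b\<in>M A. cinner w b = 0) \<Longrightarrow> w = 0"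
    "\<And>A S. A \<in> P \<Longrightarrow> orthonormal S \<Longrightarrow> S \<subseteq> ?V A \<Longrightarrow> \<kappa> \<le>o |S| \<Longrightarrow> \<kappa> \<le>o |M A|"
    using M' by auto
  have perp: "cinner b c = 0" if "A \<in> P" "A' \<in> P" "A \<noteq> A'" "b \<in> M A" "c \<in> M A'" for A A' b c
  proof -
    have "A \<inter> A' = {}"
      using part that(1-3) unfolding partition_on_def disjoint_def by blast
    then have "proj H A (proj H A' c) = 0"
      using P(1) that by (intro proj_disjoint) auto
    moreover have "proj H A b = b" "proj H A' c = c"
      using M(2) that by blast+
    ultimately show ?thesis
      using cinner_proj[OF P(1)[OF that(1)], of b c] by simp
  qed
  have M_self: "cinner b b = 1" if "A \<in> P" "b \<in> M A" for A b
    using M(1)[OF that(1)] that(2) unfolding orthonormal_family_def by simp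
  define B where "B = (\<Union>A\<in>P. M A)"
  define blk where "blk b = (SOME A. A \<in> P \<and> b \<in> M A)" for b
  \<comment> \<open>A basis vector in two distinct blocks would be orthogonal to itself, so the
    choice in \<open>blk\<close> is forced.\<close>
  have blk_eq: "blk b = A" if "A \<in> P" "b \<in> M A" for A b
  proof -
    have "blk b \<in> P \<and> b \<in> M (blk b)"
      unfolding blk_def by (rule someI) (use that in blast)
    then show ?thesis
      using perp[of "blk b" A b b] M_self[OF that] that by auto
  qed
  have fibre: "{c \<in> B. blk c = A} = M A" if "A \<in> P" for A
    using that blk_eq unfolding B_def by blast
  have "orthonormal B"
    unfolding orthonormal_family_def
  proof (intro ballI)
    fix b c assume "b \<in> B" "c \<in> B"
    then obtain A A' where A: "A \<in> P" "b \<in> M A" "A' \<in> P" "c \<in> M A'"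
      unfolding B_def by blast
    show "cinner b c = (if b = c then 1 else 0)"
    proof (cases "A = A'")
      case True
      then show ?thesis
        using A M(1)[of A] unfolding orthonormal_family_def by simp
    next
      case False
      then have "cinner b c = 0"
        using perp A by blast
      then show ?thesis
        using M_self[OF A(1,2)] by auto
    qed
  qed
  moreover have "total B"
    unfolding total_family_def
  proof (intro allI impI)
    fix w assume w: "\<forall>b\<in>B. cinner w b = 0"
    \<comment> \<open>Each component of \<open>w\<close> lies in the range over \<open>A\<close> and
      is orthogonal to \<open>M A\<close>, hence zero; \<open>w\<close> is the sum of its
      components.\<close>
    have "proj H A w = 0" if "A \<in> P" for A
    proof (rule M(3)[OF that])
      show "proj H A w \<in> ?V A"
        using projection_operatorD(3)[OF proj_projection[OF P(1)[OF that]]] by simp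
      show "\<forall>b\<in>M A. cinner (proj H A w) b = 0"
      proof
        fix b assume "b \<in> M A"
        then have "proj H A b = b" "cinner w b = 0"
          using M(2)[OF that] w that unfolding B_def by auto
        then show "cinner (proj H A w) b = 0"
          using cinner_proj[OF P(1)[OF that]] by simp
      qed
    qed
    then show "w = 0"
      by (rule has_sum_unique[OF sum has_sum_0])
  qed
  \<comment> \<open>\<open>E\<^sub>0\<close> bounds the blocks. The composite leads from
    \<open>x\<close> to a point of a nearby ample set \<open>C\<close>, inside \<open>C\<close> to a
    point of \<open>A \<inter> C\<close>, and from there to any point of \<open>A\<close>.\<close>
  moreover define E where "E = E\<^sub>0 \<union> E\<^sub>2 O E\<^sub>1 O E\<^sub>0"
  have "E \<in> entourages X"
    using E\<^sub>0 E\<^sub>1 E\<^sub>2(1) unfolding E_def gauge_def by (intro entourage_Un entourage_comp) auto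
  moreover have "\<forall>b\<in>B. blk b \<in> measurables H \<and> blk b \<times> blk b \<subseteq> E \<and> proj H (blk b) b = b"
  proof
    fix b assume "b \<in> B"
    then obtain A where A: "A \<in> P" "b \<in> M A"
      unfolding B_def by blast
    then show "blk b \<in> measurables H \<and> blk b \<times> blk b \<subseteq> E \<and> proj H (blk b) b = b"
      using P[OF A(1)] M(2)[OF A(1)] unfolding blk_eq[OF A] bounded_by_def E_def by auto
  qed
  moreover have "\<forall>x\<in>points X. \<exists>b\<in>B. {x} \<times> blk b \<subseteq> E \<and> \<kappa> \<le>o |{c \<in> B. blk c = blk b}|"
  proof
    fix x assume "x \<in> points X"
    then obtain y C where y: "(x, y) \<in> E\<^sub>2" "y \<in> C" and C: "C \<in> nonzero_blocks H E\<^sub>1"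
      using E\<^sub>2(2) by blast
    then have C': "C \<in> measurables H" "proj H C \<noteq> (\<lambda>v. 0)" "bounded_by E\<^sub>1 C"
      unfolding nonzero_blocks_def by auto
    obtain A where A: "A \<in> P" "proj H (A \<inter> C) \<noteq> (\<lambda>v. 0)"
      using partition_meets_nonzero[OF P(1) sum C'(1,2)] by blast
    have AC: "A \<inter> C \<in> measurables H"
      using measurable_Int P(1) A(1) C'(1) by blast
    \<comment> \<open>A subset of \<open>C\<close> is still bounded by \<open>E\<^sub>1\<close>, so
      ampleness gives \<open>A \<inter> C\<close>, and with it \<open>A\<close>, rank at least
      \<open>\<kappa>\<close>.\<close>
    then have "A \<inter> C \<in> nonzero_blocks H E\<^sub>1"
      using A(2) C'(3) unfolding nonzero_blocks_def bounded_by_def by auto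
    then obtain S where S: "orthonormal_basis S (range (proj H (A \<inter> C)))" "\<kappa> \<le>o |S|"
      using ample unfolding rank_at_least_def by blast
    have fixed: "proj H A (proj H (A \<inter> C) v) = proj H (A \<inter> C) v" for v
      by (rule proj_subset[OF AC P(1)[OF A(1)]])
        (use projection_operatorD(3)[OF proj_projection[OF AC]] in auto)
    have "S \<subseteq> range (proj H (A \<inter> C))"
      using S(1) complex_vector.span_superset closure_subset unfolding orthonormal_basis_def by blast
    then have "S \<subseteq> ?V A"
      using fixed by auto
    moreover have "orthonormal S"
      using S(1) unfolding orthonormal_basis_def orthonormal_family_def by blast
    ultimately have large: "\<kappa> \<le>o |M A|"
      using M(4)[OF A(1)] S(2) by blast
    \<comment> \<open>Largeness alone would not supply a basis vector when \<open>\<kappa>\<close>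
      is the zero cardinal; the nonzero projection does.\<close>
    have "M A \<noteq> {}"
    proof
      assume "M A = {}"
      then have "proj H (A \<inter> C) v = 0" for v
        using M(3)[OF A(1), of "proj H (A \<inter> C) v"] fixed by simp
      then show False
        using A(2) by blast
    qed
    then obtain b where b: "b \<in> M A"
      by blast
    obtain z where z: "z \<in> A \<inter> C"
      using A(2) proj_empty by (metis equals0I ext)
    have "{x} \<times> A \<subseteq> E"
      using y z C'(3) P(2)[OF A(1)] unfolding E_def bounded_by_def by blast
    then show "\<exists>b\<in>B. {x} \<times> blk b \<subseteq> E \<and> \<kappa> \<le>o |{c \<in> B. blk c = blk b}|"
      using large b A(1) blk_eq[OF A(1) b] fibre[OF A(1)] unfolding B_def
      by (intro bexI[of _ b]) auto
  qed
  ultimately have "adapted_basis \<kappa> X H E B blk"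
    unfolding adapted_basis_def by blast
  then show thesis
    by (rule that)
qed

lemma (in coarse_module) adapted_block_nonempty:
  assumes "adapted_basis \<kappa> X H E B A" "b \<in> B"
  shows "A b \<noteq> {}"
proof
  assume "A b = {}"
  then have "b = 0"
    using assms proj_empty[of b] unfolding adapted_basis_def by auto
  then show False
    using norm_orthonormal[of "\<lambda>b. b" B b] assms unfolding adapted_basis_def by simp
qed

section \<open>Operators covering coarse maps\<close>

text \<open>The union \<open>S\<close> of the rectangles joining the block of \<open>b\<close> to
  the block of \<open>j b\<close> is a least support. It lies near \<open>R\<close> by
  \<open>close\<close>, and \<open>R\<close> lies near \<open>S\<close> because blocks come close to
  every point and \<open>R\<close> is controlled.\<close>

lemma adapted_basis_operator_support:
  assumes X: "coarse_space X" and Y: "coarse_space Y"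
    and HX: "coarse_module X HX" and HY: "coarse_module Y HY"
    and B: "adapted_basis \<kappa> X HX E B A" and D: "adapted_basis \<mu> Y HY F D C"
    and R: "controlled_relation X Y R"
    and G: "G \<in> entourages Y" and K: "K \<in> entourages X"
    and j: "inj_on j B" "j ` B \<subseteq> D"
    and close: "\<And>b. b \<in> B \<Longrightarrow> C (j b) \<times> A b \<subseteq> G O R O K"
  shows "coarse_support X HX Y HY (basis_operator B j) = rel_class X Y R"
proof -
  interpret X: coarse_space X by fact
  interpret Y: coarse_space Y by fact
  interpret HX: coarse_module X HX by fact
  interpret HY: coarse_module Y HY by fact
  let ?t = "basis_operator B j"
  have onB: "orthonormal B" "total B" and onD: "orthonormal D"
    using B D unfolding adapted_basis_def by blast+
  have on_j: "orthonormal_family j B"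
    by (rule orthonormal_family_inj_on[OF onD j])
  have E: "E \<in> entourages X" and F: "F \<in> entourages Y"
    using B D unfolding adapted_basis_def by blast+
  have blkX: "A b \<in> measurables HX" "A b \<times> A b \<subseteq> E" "proj HX (A b) b = b" if "b \<in> B" for b
    using B that unfolding adapted_basis_def by blast+
  have blkY: "C d \<in> measurables HY" "C d \<times> C d \<subseteq> F" "proj HY (C d) d = d" if "d \<in> D" for d
    using D that unfolding adapted_basis_def by blast+
  have jD: "j b \<in> D" if "b \<in> B" for b
    using j(2) that by blast
  define S where "S = (\<Union>b\<in>B. C (j b) \<times> A b)"
  have "S \<subseteq> points Y \<times> points X"
    using HX.measurable_subset[OF blkX(1)] HY.measurable_subset[OF blkY(1)[OF jD]]
    unfolding S_def by blast
  moreover have "supp_subset HX HY ?t S"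
    unfolding supp_subset_def
  proof (intro ballI impI allI)
    fix U V v assume U: "U \<in> measurables HY" and V: "V \<in> measurables HX" and sep: "separated S U V"
    \<comment> \<open>If \<open>V\<close> misses \<open>A b\<close>, the coefficient at
      \<open>b\<close> vanishes; otherwise separation forces \<open>U\<close> to miss
      \<open>C (j b)\<close>, and the projection kills \<open>j b\<close>.\<close>
    have zero: "proj HY U (cinner (proj HX V v) b *\<^sub>C j b) = 0" if b: "b \<in> B" for b
    proof (cases "V \<inter> A b = {}")
      case True
      have "cinner (proj HX V v) b = cinner v (proj HX V (proj HX (A b) b))"
        using HX.cinner_proj[OF V] blkX(3)[OF b] by simp
      then show ?thesis
        using HX.proj_disjoint[OF V blkX(1)[OF b] True] HY.proj_zero[OF U] by simp
    next
      case False
      then have "U \<inter> C (j b) = {}"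
        using sep b unfolding separated_def S_def by blast
      then have "proj HY U (j b) = 0"
        using HY.proj_disjoint[OF U blkY(1)[OF jD[OF b]]] blkY(3)[OF jD[OF b]] by metis
      then show ?thesis
        using projection_operatorD(2)[OF HY.proj_projection[OF U]] by simp
    qed
    have "((\<lambda>b. proj HY U (cinner (proj HX V v) b *\<^sub>C j b)) has_sum
        proj HY U (?t (proj HX V v))) B"
      by (rule has_sum_bounded_linear[OF projection_operatorD(1)[OF HY.proj_projection[OF U]]
            has_sum_basis_operator[OF onB on_j]])
    from has_sum_unique[OF this has_sum_0[OF zero]]
    show "proj HY U (?t (proj HX V v)) = 0" .
  qed
  moreover have "rel_coarse_le X Y S T" if T: "supp_subset HX HY ?t T" for T
  proof -
    \<comment> \<open>Compressed to the rectangle, the operator still sends \<open>b\<close> to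
      \<open>j b\<close>, which is nonzero. Hence \<open>T\<close> meets the rectangle, and bounded
      blocks spread that one pair over all of it.\<close>
    have "C (j b) \<times> A b \<subseteq> F O T O E" if b: "b \<in> B" for b
    proof -
      have "proj HY (C (j b)) (?t (proj HX (A b) b)) = j b"
        using blkX(3)[OF b] blkY(3)[OF jD[OF b]] basis_operator_basis[OF onB on_j b] by simp
      moreover have "j b \<noteq> 0"
        using norm_orthonormal[OF on_j b] by auto
      ultimately have "\<not> separated T (C (j b)) (A b)"
        using T blkX(1)[OF b] blkY(1)[OF jD[OF b]] unfolding supp_subset_def by metis
      then show ?thesis
        using blkX(2)[OF b] blkY(2)[OF jD[OF b]] unfolding separated_def by blast
    qed
    then show ?thesis
      unfolding rel_coarse_le_def S_def using E F by blast
  qed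
  ultimately have "least_support X HX Y HY ?t S"
    unfolding least_support_def by blast
  then have "coarse_support X HX Y HY ?t = rel_class X Y S"
    by (rule coarse_support_eqI[OF X Y])
  moreover have "rel_coarse_le X Y S R"
    unfolding rel_coarse_le_def S_def using G K close by blast
  moreover have "rel_coarse_le X Y R S"
  proof -
    \<comment> \<open>\<open>W\<close> joins \<open>y\<close> to \<open>c'\<close> by way of
      \<open>x\<close>, \<open>a\<close> and \<open>x'\<close>, where \<open>x\<close> and
      \<open>x'\<close> are close; controlledness of \<open>R\<close> makes it an entourage.\<close>
    define W where "W = R O (E O K\<inverse>) O R\<inverse>"
    have "R \<subseteq> (W O G\<inverse>) O S O E\<inverse>"
    proof (rule subrelI)
      fix y x assume yx: "(y, x) \<in> R"
      then have "x \<in> points X"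
        using R unfolding controlled_relation_def by blast
      then obtain b where b: "b \<in> B" "{x} \<times> A b \<subseteq> E"
        using B unfolding adapted_basis_def by blast
      obtain a c where a: "a \<in> A b" and c: "c \<in> C (j b)"
        using HX.adapted_block_nonempty[OF B b(1)] HY.adapted_block_nonempty[OF D jD[OF b(1)]]
        by blast
      then obtain c' x' where "(c, c') \<in> G" "(c', x') \<in> R" "(x', a) \<in> K"
        using close[OF b(1)] by blast
      moreover have "(x, a) \<in> E" "(c, a) \<in> S"
        using a b c unfolding S_def by blast+
      ultimately show "(y, x) \<in> (W O G\<inverse>) O S O E\<inverse>"
        using yx unfolding W_def by blast
    qed
    moreover have "E O K\<inverse> \<in> entourages X"
      using E K by (intro X.entourage_comp X.entourage_converse)
    then have "W \<in> entourages Y"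
      using R unfolding W_def controlled_relation_def by blast
    then have "W O G\<inverse> \<in> entourages Y"
      using G by (intro Y.entourage_comp Y.entourage_converse)
    ultimately show ?thesis
      unfolding rel_coarse_le_def using X.entourage_converse[OF E] by blast
  qed
  ultimately show ?thesis
    unfolding rel_class_def using rel_coarse_le_trans[OF X Y] by blast
qed

text \<open>From a point of \<open>A b\<close> one moves by \<open>K\<close> and \<open>T\<close> to
  a point of \<open>Y\<close>, near which there is a large block of \<open>D\<close>. This serves
  both directions: \<open>T\<close> is \<open>R\<close> for the isometry and the converse of a
  thickened \<open>R\<close> for the return injection.\<close>

lemma adapted_basis_injection:
  assumes HX: "coarse_module X HX"
    and B: "adapted_basis \<mu> X HX E B A" "|B| \<le>o \<kappa>" and D: "adapted_basis \<kappa> Y HY F D C"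
    and T: "T \<subseteq> points Y \<times> points X" and dense: "points X \<subseteq> Range (T O K)" "K \<in> entourages X"
  obtains j where "inj_on j B" "j ` B \<subseteq> D"
    "\<And>b. b \<in> B \<Longrightarrow> C (j b) \<times> A b \<subseteq> F\<inverse> O T O (K O E)"
proof -
  interpret HX: coarse_module X HX by fact
  have "\<exists>c\<in>D. C c \<times> A b \<subseteq> F\<inverse> O T O (K O E) \<and> \<kappa> \<le>o |{d \<in> D. C d = C c}|"
    if b: "b \<in> B" for b
  proof -
    obtain a where a: "a \<in> A b"
      using HX.adapted_block_nonempty[OF B(1) b] by blast
    have "A b \<subseteq> points X" "A b \<times> A b \<subseteq> E"
      using HX.measurable_subset B(1) b unfolding adapted_basis_def by blast+
    then obtain y x where yx: "(y, x) \<in> T" "(x, a) \<in> K" "{a} \<times> A b \<subseteq> E"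
      using a dense(1) by blast
    then obtain c where c: "c \<in> D" "{y} \<times> C c \<subseteq> F" "\<kappa> \<le>o |{d \<in> D. C d = C c}|"
      using T D unfolding adapted_basis_def by blast
    then have "C c \<times> A b \<subseteq> F\<inverse> O T O (K O E)"
      using yx by blast
    then show ?thesis
      using c by blast
  qed
  then obtain j where "inj_on j B" "j ` B \<subseteq> D"
    "\<And>b. b \<in> B \<Longrightarrow> C (j b) \<times> A b \<subseteq> F\<inverse> O T O (K O E)"
    using fiberwise_injection[OF B(2), of D "\<lambda>b L. L \<times> A b \<subseteq> F\<inverse> O T O (K O E)" C] by blast
  then show thesis
    by (rule that)
qed

section \<open>Coarse surjectivity of equivalences and bounds by the rank\<close>

lemma rel_class_self:
  assumes "coarse_space X" "coarse_space Y" "R \<subseteq> points Y \<times> points X"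
  shows "R \<in> rel_class X Y R"
proof -
  have "R \<subseteq> Id_on (points Y) O R O Id_on (points X)"
    using assms(3) by blast
  then have "rel_coarse_le X Y R R"
    unfolding rel_coarse_le_def using assms(1,2)[THEN coarse_space.entourage_diagonal] by blast
  then show ?thesis
    unfolding rel_class_def using assms(3) by blast
qed

text \<open>The composite with \<open>g\<close> is close to the identity of \<open>Y\<close>, so
  every \<open>y\<close> is near a value of a function \<open>\<gamma>\<close> representing the map,
  and the graph of \<open>\<gamma>\<close> is near \<open>R\<close>.\<close>

lemma coarse_equivalence_dense_image:
  assumes X: "coarse_space X" and Y: "coarse_space Y"
    and "coarse_equivalence X Y (rel_class X Y R)"  obtains G K where "G \<in> entourages Y" "K \<in> entourages X" "points Y \<subseteq> Domain (G O R O K)"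
proof -
  interpret Y: coarse_space Y by fact
  obtain g where g: "coarse_comp Y X Y (rel_class X Y R) g = coarse_id Y"
    using assms(3) unfolding coarse_equivalence_def by blast
  \<comment> \<open>\<open>coarse_comp\<close> is a comprehension over representing functions;
    exhibiting one member of it is what produces the functions \<open>\<phi>\<close> and
    \<open>\<gamma>\<close>.\<close>
  have "Id_on (points Y) \<in> coarse_id Y"
    unfolding coarse_id_def using rel_class_self[OF Y Y] by blast
  then have "Id_on (points Y) \<in> coarse_comp Y X Y (rel_class X Y R) g"
    unfolding g .
  then obtain \<phi> \<gamma> where \<phi>: "\<phi> \<in> points Y \<rightarrow> points X"
    and \<gamma>: "\<gamma> \<in> points X \<rightarrow> points Y" "rel_class X Y R = rel_class X Y (graph_rel X \<gamma>)"
    and "Id_on (points Y) \<in> rel_class Y Y (graph_rel Y (\<gamma> \<circ> \<phi>))"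
    unfolding coarse_comp_def represents_def mem_Collect_eq by (elim exE conjE)
  then have id: "rel_coarse_le Y Y (Id_on (points Y)) (graph_rel Y (\<gamma> \<circ> \<phi>))"
    unfolding rel_class_def by blast
  obtain G K where GK: "G \<in> entourages Y" "K \<in> entourages Y"
    "Id_on (points Y) \<subseteq> G O graph_rel Y (\<gamma> \<circ> \<phi>) O K"
    using id unfolding rel_coarse_le_def by blast
  have "graph_rel X \<gamma> \<subseteq> points Y \<times> points X"
    using \<gamma>(1) unfolding graph_rel_def by auto
  then have "graph_rel X \<gamma> \<in> rel_class X Y R"
    unfolding \<gamma>(2) by (rule rel_class_self[OF X Y])
  then have "rel_coarse_le X Y (graph_rel X \<gamma>) R"
    unfolding rel_class_def by blast
  then obtain G' K' where GK': "G' \<in> entourages Y" "K' \<in> entourages X"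
    "graph_rel X \<gamma> \<subseteq> G' O R O K'"
    unfolding rel_coarse_le_def by blast
  have "points Y \<subseteq> Domain ((G O G') O R O K')"
  proof
    fix y assume "y \<in> points Y"
    then have "(y, y) \<in> G O graph_rel Y (\<gamma> \<circ> \<phi>) O K"
      using GK(3) by blast
    then obtain y' where "(y, \<gamma> (\<phi> y')) \<in> G" "y' \<in> points Y"
      unfolding graph_rel_def by auto
    moreover have "(\<gamma> (\<phi> y'), \<phi> y') \<in> graph_rel X \<gamma>"
      using \<phi> \<open>y' \<in> points Y\<close> unfolding graph_rel_def by blast
    ultimately show "y \<in> Domain ((G O G') O R O K')"
      using GK'(3) by blast
  qed
  then show thesis
    using that[of "G O G'" K'] GK(1) GK'(1,2) Y.entourage_comp by blast
qed

lemma orthonormal_ordLeq_rank: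
  fixes B :: "'h::complex_hilbert_space set"
  assumes "orthonormal B" "has_rank (UNIV :: 'h set) \<kappa>"
  shows "|B| \<le>o \<kappa>"
proof -
  obtain D :: "'h set" where D: "orthonormal_basis D UNIV" "|D| =o \<kappa>"
    using assms(2) unfolding has_rank_def by blast
  then have "orthonormal D" "total D"
    using total_if_dense_span unfolding orthonormal_basis_def orthonormal_family_def by blast+
  then have "|B| \<le>o |D|"
    by (rule orthonormal_ordLeq_total[OF assms(1)])
  then show ?thesis
    using D(2) by (rule ordLeq_ordIso_trans)
qed

theorem theorem1p1:
  fixes \<kappa> :: "'k rel"
    and X :: "'x coarse" and Y :: "'y coarse"
    and HX :: "('x, 'h::complex_hilbert_space) module_data"
    and HY :: "('y, 'g::complex_hilbert_space) module_data"
  assumes "Card_order \<kappa>"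
    and "coarse_space X" and "coarse_space Y"
    and "coarse_module X HX" and "coarse_module Y HY"
    and "discrete_module X HX" and "ample_module \<kappa> X HX" and "module_has_rank HX \<kappa>"
    and "discrete_module Y HY" and "ample_module \<kappa> Y HY" and "module_has_rank HY \<kappa>"
  shows "\<forall>f. coarse_map X Y f \<longrightarrow>
    (\<exists>t. controlled_operator X HX Y HY t \<and> isometry_operator t \<and>
         coarse_support X HX Y HY t = f) \<and>
    (coarse_equivalence X Y f \<longrightarrow>
      (\<exists>t. controlled_operator X HX Y HY t \<and> unitary_operator t \<and>
           coarse_support X HX Y HY t = f))"
proof (intro allI impI)
  fix f assume "coarse_map X Y f"
  then obtain R where R: "controlled_relation X Y R" "coarsely_dense X (Range R)"
    and f: "f = rel_class X Y R"
    unfolding coarse_map_def by blast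
  interpret X: coarse_space X by fact
  interpret Y: coarse_space Y by fact
  obtain E B A where B: "adapted_basis \<kappa> X HX E B A"
    using coarse_module.adapted_basis_exists[OF assms(4,2,6,7)] .
  obtain F D C where D: "adapted_basis \<kappa> Y HY F D C"
    using coarse_module.adapted_basis_exists[OF assms(5,3,9,10)] .
  have E: "E \<in> entourages X" and onB: "orthonormal B" "total B"
    and F: "F \<in> entourages Y" and onD: "orthonormal D" "total D"
    using B D unfolding adapted_basis_def by blast+
  have cardB: "|B| \<le>o \<kappa>" and cardD: "|D| \<le>o \<kappa>"
    using orthonormal_ordLeq_rank onB(1) onD(1) assms(8,11) unfolding module_has_rank_def by blast+
  \<comment> \<open>Both conclusions reduce to an injection of \<open>B\<close> into
    \<open>D\<close> whose rectangles stay near \<open>R\<close>.\<close>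
  have operator: "controlled_operator X HX Y HY (basis_operator B h) \<and>
      isometry_operator (basis_operator B h) \<and>
      coarse_support X HX Y HY (basis_operator B h) = f"
    if "inj_on h B" "h ` B \<subseteq> D" "G \<in> entourages Y" "K \<in> entourages X"
      "\<And>b. b \<in> B \<Longrightarrow> C (h b) \<times> A b \<subseteq> G O R O K" for h G K
  proof -
    have "isometry_operator (basis_operator B h)"
      by (rule isometry_basis_operator[OF onB orthonormal_family_inj_on[OF onD(1) that(1,2)]])
    moreover have "coarse_support X HX Y HY (basis_operator B h) = f"
      unfolding f using adapted_basis_operator_support[OF assms(2-5) B D R(1) that(3,4,1,2,5)] .
    moreover have "partial_coarse_map X Y f"
      unfolding partial_coarse_map_def f using R(1) by blast
    ultimately show ?thesis
      unfolding controlled_operator_def isometry_operator_def by simp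
  qed
  obtain L where L: "L \<in> entourages X" "points X \<subseteq> rel_image L (Range R)"
    using R(2) unfolding coarsely_dense_def set_coarse_le_def by blast
  have L': "L\<inverse> \<in> entourages X"
    by (rule X.entourage_converse[OF L(1)])
  have "R \<subseteq> points Y \<times> points X"
    using R(1) unfolding controlled_relation_def by blast
  moreover have "points X \<subseteq> Range (R O L\<inverse>)"
    using L(2) by blast
  ultimately obtain j where j: "inj_on j B" "j ` B \<subseteq> D"
    "\<And>b. b \<in> B \<Longrightarrow> C (j b) \<times> A b \<subseteq> F\<inverse> O R O (L\<inverse> O E)"
    using adapted_basis_injection[OF assms(4) B cardB D _ _ L'] by blast
  have jE: "F\<inverse> \<in> entourages Y" "L\<inverse> O E \<in> entourages X"
    by (rule Y.entourage_converse[OF F], rule X.entourage_comp[OF L' E])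
  show "(\<exists>t. controlled_operator X HX Y HY t \<and> isometry_operator t \<and>
         coarse_support X HX Y HY t = f) \<and>
    (coarse_equivalence X Y f \<longrightarrow>
      (\<exists>t. controlled_operator X HX Y HY t \<and> unitary_operator t \<and>
           coarse_support X HX Y HY t = f))"
  proof (intro conjI impI)
    show "\<exists>t. controlled_operator X HX Y HY t \<and> isometry_operator t \<and>
        coarse_support X HX Y HY t = f"
      using operator[OF j(1,2) jE j(3)] by blast
  next
    assume "coarse_equivalence X Y f"
    then obtain G K where GK: "G \<in> entourages Y" "K \<in> entourages X"
      "points Y \<subseteq> Domain (G O R O K)"
      using coarse_equivalence_dense_image[OF assms(2,3)] unfolding f by blast
    \<comment> \<open>The return injection follows the converse of the thickened \<open>R\<close>.
      The thickening already reaches every point of \<open>Y\<close>, so the slot for a further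
      entourage takes the diagonal.\<close>
    let ?T = "(G O R O K)\<inverse>" and ?I = "Id_on (points Y)"
    have "?T \<subseteq> points X \<times> points Y"
      using Y.entourage_subset[OF GK(1)] X.entourage_subset[OF GK(2)] by blast
    moreover have "points Y \<subseteq> Range (?T O ?I)"
      using GK(3) by blast
    ultimately obtain k where k: "inj_on k D" "k ` D \<subseteq> B"
      "\<And>d. d \<in> D \<Longrightarrow> A (k d) \<times> C d \<subseteq> E\<inverse> O ?T O (?I O F)"
      using adapted_basis_injection[OF assms(5) D cardD B _ _ Y.entourage_diagonal] by blast
    obtain h where h: "bij_betw h B D" "\<And>b. b \<in> B \<Longrightarrow> h b = j b \<or> k (h b) = b"
      using Schroeder_Bernstein_graph[OF j(1,2) k(1,2)] by blast
    have inj: "inj_on h B" and img: "h ` B = D"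
      using h(1) unfolding bij_betw_def by blast+
    \<comment> \<open>The bijection agrees at each \<open>b\<close> with \<open>j\<close> or with an
      inverse of \<open>k\<close>; the unions hold the bounds of both cases.\<close>
    define G' where "G' = F\<inverse> \<union> (?I O F)\<inverse> O G"
    define K' where "K' = (L\<inverse> O E) \<union> K O E"
    have G': "G' \<in> entourages Y"
      unfolding G'_def using F GK(1)
      by (intro Y.entourage_Un Y.entourage_comp Y.entourage_converse Y.entourage_diagonal)
    have K': "K' \<in> entourages X"
      unfolding K'_def using E GK(2) L' by (intro X.entourage_Un X.entourage_comp)
    have close: "C (h b) \<times> A b \<subseteq> G' O R O K'" if b: "b \<in> B" for b
      using h(2)[OF b]
    proof
      assume "h b = j b"
      then have "C (h b) \<times> A b \<subseteq> F\<inverse> O R O (L\<inverse> O E)"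
        using j(3)[OF b] by simp
      also have "\<dots> \<subseteq> G' O R O K'"
        unfolding G'_def K'_def by (intro relcomp_mono order_refl Un_upper1)
      finally show ?thesis .
    next
      assume "k (h b) = b"
      then have "A b \<times> C (h b) \<subseteq> E\<inverse> O ?T O (?I O F)"
        using k(3)[of "h b"] b img by auto
      \<comment> \<open>Transposing the bound for \<open>k\<close> at \<open>h b\<close> turns
        \<open>?T\<close> back into the thickened \<open>R\<close>.\<close>
      then have "C (h b) \<times> A b \<subseteq> ((?I O F)\<inverse> O G) O R O (K O E)"
        by blast
      also have "\<dots> \<subseteq> G' O R O K'"
        unfolding G'_def K'_def by (intro relcomp_mono order_refl Un_upper2)
      finally show ?thesis .
    qed
    have "orthonormal_family h B"
      using orthonormal_family_inj_on[OF onD(1) inj] img by blast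
    moreover have "total_family h B"
      using total_family_image onD(2) img by blast
    ultimately have "unitary_operator (basis_operator B h)"
      by (rule unitary_basis_operator[OF onB])
    then show "\<exists>t. controlled_operator X HX Y HY t \<and> unitary_operator t \<and>
        coarse_support X HX Y HY t = f"
      using operator[OF inj _ G' K' close] img by blast
  qed
qed

end
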